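(* Let $n\ge1$, $\lambda>0$ and $X=\begin{pmatrix}A&B\\ \bar B&\bar A\end{pmatrix}\in\mathfrak s$. Then, for every $z\in\mathbb C^n$, $$W_0(d\sigma(X))(z)=\tfrac{\lambda}{4}\left(z(\bar Bz)-\bar z(B\bar z)-2(Az)\bar z\right).$$
   Context: For $z,w\in\mathbb C^n$, $zw:=\sum_{j=1}^n z_jw_j$ (bilinear); $|z|^2=z\bar z$. $S$ is the group of all matrices $k=\begin{pmatrix}P&Q\\ \bar Q&\bar P\end{pmatrix}$ with $P,Q\in M_n(\mathbb C)$, $PP^*-QQ^*=I_n$, $PQ^t=QP^t$. Its Lie algebra $\mathfrak s$ consists of the matrices $\begin{pmatrix}A&B\\ \bar B&\bar A\end{pmatrix}$ with $A^*=-A$, $B^t=B$. $\mathcal F_\lambda$ is the Hilbert space of holomorphic functions $f$ on $\mathbb C^n$ with $\|f\|^2=\int_{\mathbb C^n}|f(z)|^2e^{-\lambda|z|^2/2}\,d\mu_\lambda(z)<\infty$, $d\mu_\lambda(z)=(2\pi)^{-n}\lambda^n\,dm(z)$, $dm$ Lebesgue measure. With $e_w(z)=\exp(\lambda\bar wz/2)$, the kernel of an operator $A$ is $k_A(z,w)=(Ae_w)(z)$, and $(Af)(z)=\int k_A(z,w)f(w)e^{-\lambda|w|^2/2}d\mu_\lambda(w)$. The metaplectic operator $\sigma(k)$, $k\in S$, is the operator on $\mathcal F_\lambda$ with kernel $$b_k(z,w)=(\operatorname{Det}P)^{-1/2}\exp\left(\tfrac{\lambda}{4}\left(z(\bar QP^{-1}z)+2(P^{-1}z)\bar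 w-\bar w(P^{-1}Q\bar w)\right)\right)$$ (principal square root). For $X\in\mathfrak s$, $d\sigma(X)$ is the differential of $\sigma$, i.e. $(d\sigma(X)f)(z)=\frac{d}{dt}\big|_{t=0}(\sigma(\exp tX)f)(z)$; its kernel is $b_X(z,w)=\frac{d}{dt}\big|_{t=0}b_{\exp(tX)}(z,w)$. The complex Weyl symbol of an operator $A$ on $\mathcal F_\lambda$ (not necessarily bounded or trace class) is $$W_0(A)(z)=2^n\int_{\mathbb C^n}k_A(z+w,z-w)\exp\left(\tfrac{\lambda}{2}(-z\bar z-w\bar w+z\bar w-\bar zw)\right)d\mu_\lambda(w).$$ *)

theory Defs
  imports "HOL-Analysis.Analysis"
begin

text \<open>A \<open>2n \<times> 2n\<close> matrix is indexed by the disjoint sum \<open>'n + 'n\<close>.\<close>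

definition bil :: "complex ^ 'n \<Rightarrow> complex ^ 'n \<Rightarrow> complex" (infixl "\<odot>" 68) where
  "z \<odot> w = (\<Sum>j\<in>UNIV. z $ j * w $ j)"

definition vcnj :: "complex ^ 'n \<Rightarrow> complex ^ 'n" where
  "vcnj z = (\<chi> j. cnj (z $ j))"

abbreviation mcnj :: "complex ^ 'n ^ 'm \<Rightarrow> complex ^ 'n ^ 'm" where
  "mcnj \<equiv> map_matrix cnj"

definition adjmat :: "complex ^ 'n ^ 'm \<Rightarrow> complex ^ 'm ^ 'n" where
  "adjmat M = transpose (mcnj M)"

definition block ::
  "complex ^ 'n ^ 'n \<Rightarrow> complex ^ 'n ^ 'n \<Rightarrow> complex ^ 'n ^ 'n \<Rightarrow> complex ^ 'n ^ 'n
    \<Rightarrow> complex ^ ('n::finite + 'n) ^ ('n + 'n)" where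
  "block P Q R T = (\<chi> i j. case i of
      Inl a \<Rightarrow> (case j of Inl b \<Rightarrow> P $ a $ b | Inr b \<Rightarrow> Q $ a $ b)
    | Inr a \<Rightarrow> (case j of Inl b \<Rightarrow> R $ a $ b | Inr b \<Rightarrow> T $ a $ b))"

definition upper_left :: "complex ^ ('n::finite + 'n) ^ ('n + 'n) \<Rightarrow> complex ^ 'n ^ 'n" where
  "upper_left M = (\<chi> i j. M $ Inl i $ Inl j)"

definition upper_right :: "complex ^ ('n::finite + 'n) ^ ('n + 'n) \<Rightarrow> complex ^ 'n ^ 'n" where
  "upper_right M = (\<chi> i j. M $ Inl i $ Inr j)"

text \<open>The type \<open>complex ^ 'm ^ 'm\<close> is not a Banach algebra instance (its \<open>*\<close> is
  componentwise), so the matrix exponential is given by its power series.\<close>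

definition mexp :: "complex ^ 'm ^ 'm \<Rightarrow> complex ^ 'm ^ 'm" where
  "mexp M = (\<Sum>k. (1 / fact k) *\<^sub>R (((**) M ^^ k) (mat 1)))"


definition S_group :: "(complex ^ ('n::finite + 'n) ^ ('n + 'n)) set" where
  "S_group = {block P Q (mcnj Q) (mcnj P) | P Q.
     P ** adjmat P - Q ** adjmat Q = mat 1 \<and> P ** transpose Q = Q ** transpose P}"

definition s_algebra :: "(complex ^ ('n::finite + 'n) ^ ('n + 'n)) set" where
  "s_algebra = {block A B (mcnj B) (mcnj A) | A B. adjmat A = - A \<and> transpose B = B}"


text \<open>A function on \<open>\<complex>\<^sup>n\<close> is holomorphic if it has a complex-linear
  Frechet derivative at every point.\<close>

definition entire :: "(complex ^ 'n \<Rightarrow> complex) \<Rightarrow> bool" where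
  "entire f \<longleftrightarrow> (\<forall>z. \<exists>D. (f has_derivative D) (at z) \<and> (\<forall>c v. D (c *s v) = c * D v))"

definition mu :: "real \<Rightarrow> (complex ^ 'n) measure" where
  "mu lam = density lborel (\<lambda>_. ennreal ((lam / (2 * pi)) ^ CARD('n)))"

definition weight :: "real \<Rightarrow> complex ^ 'n \<Rightarrow> real" where
  "weight lam z = exp (- lam * (norm z)\<^sup>2 / 2)"

definition fock :: "real \<Rightarrow> (complex ^ 'n \<Rightarrow> complex) set" where
  "fock lam = {f. entire f \<and> integrable (mu lam) (\<lambda>z. (cmod (f z))\<^sup>2 * weight lam z)}"

definition coherent :: "real \<Rightarrow> complex ^ 'n \<Rightarrow> complex ^ 'n \<Rightarrow> complex" where
  "coherent lam w z = exp (of_real lam * (vcnj w \<odot> z) / 2)"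


text \<open>Operators on the Fock space are functions on functions, specified on the Fock space
  (or on a subspace containing the coherent states) only.\<close>

type_synonym 'n op = "(complex ^ 'n \<Rightarrow> complex) \<Rightarrow> complex ^ 'n \<Rightarrow> complex"

definition kernel :: "real \<Rightarrow> 'n::finite op \<Rightarrow> complex ^ 'n \<Rightarrow> complex ^ 'n \<Rightarrow> complex" where
  "kernel lam A z w = A (coherent lam w) z"

definition op_of_kernel ::
  "real \<Rightarrow> (complex ^ 'n \<Rightarrow> complex ^ 'n \<Rightarrow> complex) \<Rightarrow> 'n::finite op" where
  "op_of_kernel lam k = (\<lambda>f\<in>fock lam. \<lambda>z.
     \<integral>w. k z w * f w * of_real (weight lam w) \<partial>mu lam)"

definition b_kernel ::
  "real \<Rightarrow> complex ^ ('n::finite + 'n) ^ ('n + 'n) \<Rightarrow> complex ^ 'n \<Rightarrow> complex ^ 'n \<Rightarrow> complex" where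
  "b_kernel lam k z w =
    (let P = upper_left k; Q = upper_right k; P' = matrix_inv P in
      inverse (csqrt (det P)) *
      exp (of_real lam / 4 *
        (z \<odot> ((mcnj Q ** P') *v z) + 2 * ((P' *v z) \<odot> vcnj w)
          - vcnj w \<odot> ((P' ** Q) *v vcnj w))))"

definition metaplectic ::
  "real \<Rightarrow> complex ^ ('n::finite + 'n) ^ ('n + 'n) \<Rightarrow> 'n::finite op" where
  "metaplectic lam = (\<lambda>k\<in>S_group. op_of_kernel lam (b_kernel lam k))"

definition d_metaplectic ::
  "real \<Rightarrow> complex ^ ('n::finite + 'n) ^ ('n + 'n) \<Rightarrow> 'n::finite op" where
  "d_metaplectic lam X = (\<lambda>f\<in>fock lam. \<lambda>z.
     vector_derivative (\<lambda>t::real. metaplectic lam (mexp (t *\<^sub>R X)) f z) (at 0))"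


definition weyl_integrand ::
  "real \<Rightarrow> 'n::finite op \<Rightarrow> complex ^ 'n \<Rightarrow> complex ^ 'n \<Rightarrow> complex" where
  "weyl_integrand lam A z w =
    kernel lam A (z + w) (z - w) *
    exp (of_real lam / 2 *
      (- (z \<odot> vcnj z) - (w \<odot> vcnj w) + (z \<odot> vcnj w) - (vcnj z \<odot> w)))"

definition weyl_symbol :: "real \<Rightarrow> 'n::finite op \<Rightarrow> complex ^ 'n \<Rightarrow> complex" where
  "weyl_symbol lam A z = 2 ^ CARD('n) * (\<integral>w. weyl_integrand lam A z w \<partial>mu lam)"

end

theory Submission
  imports Defs "HOL-Probability.Distributions"
begin

text \<open>
  The operator \<open>\<sigma>(k)\<close> applied to the coherent state \<open>e\<^sub>w\<close> at \<open>z\<close> is \<open>b\<^sub>k(z,w)\<close> by the reproducing property: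
  after the translation by \<open>w\<close>, the integrand is antiholomorphic times a Gaussian, and rotation
  invariance kills all terms of its power series but the constant one. Since \<open>exp(tX)\<close> has
  \<open>P = 1 + tA + o(t)\<close> and \<open>Q = tB + o(t)\<close>, the kernel of \<open>d\<sigma>(X)\<close> is a quadratic polynomial in \<open>z\<close> and the
  conjugate of \<open>w\<close>, with constant term \<open>-tr A / 2\<close>, times \<open>e\<^sub>w(z)\<close>. In the Weyl integral all
  exponentials combine to \<open>exp(-\<lambda>|w|\<^sup>2)\<close>, so its value is a Gaussian expectation; the only second
  moment that survives, coming from the term in \<open>A\<close>, is \<open>tr A / 2\<close>, which cancels the constant
  term.
\<close>

subsection \<open>Lebesgue measure and Gaussian integrals\<close>

text \<open>The differential is taken of integral operators that are specified only on
  \<open>S_group\<close> and on the Fock space, so differentiating the formula for the kernel is not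
  enough. The curve exp(tX) must stay in the group, the coherent states must lie in the Fock space,
  and the operator must really reproduce its kernel. The last point is the obstacle: the weight
  exp(-lam |w|^2 / 2) competes with a quadratic exponent of coefficient lam/4 in
  \<open>P\<^sup>-\<^sup>1 Q\<close>. A bound by 1 on the form of \<open>P\<^sup>-\<^sup>1 Q\<close>
  leaves half of the weight to spare, and Q = 0 at t = 0 provides this bound for small t. The two
  traces have different origins. The constant -tr A / 2 is the derivative of the factor
  Det(P)^(-1/2) at the identity. In the Weyl integral, the term -2 (A u) conj(v) with u = z + w and
  v = z - w changes sign in its w-part and becomes +2 (A w) conj(w); its mean under the Gaussian of
  covariance 1/lam is 2 tr A / lam, and the factor lam/4 makes it tr A / 2.\<close>

lemma nn_integral_lborel_translate:
  fixes f :: "'a::euclidean_space \<Rightarrow> ennreal"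
  assumes [measurable]: "f \<in> borel_measurable borel"
  shows "(\<integral>\<^sup>+x. f (c + x) \<partial>lborel) = (\<integral>\<^sup>+x. f x \<partial>lborel)"
proof -
  have "(\<integral>\<^sup>+x. f x \<partial>distr lborel borel ((+) c)) = (\<integral>\<^sup>+x. f (c + x) \<partial>lborel)"
    by (rule nn_integral_distr) auto
  then show ?thesis by (simp add: lborel_distr_plus)
qed

lemma lborel_integral_translate:
  fixes f :: "'a::euclidean_space \<Rightarrow> complex"
  assumes [measurable]: "f \<in> borel_measurable borel"
  shows "(\<integral>x. f (c + x) \<partial>lborel) = (\<integral>x. f x \<partial>lborel)"
proof -
  have "(\<integral>x. f x \<partial>distr lborel borel ((+) c)) = (\<integral>x. f (c + x) \<partial>lborel)"
    by (rule integral_distr) auto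
  then show ?thesis by (simp add: lborel_distr_plus)
qed

text \<open>As in the uniqueness proof for Haar measure: by Tonelli and translation invariance, the two
  measures of \<open>A\<close> become equal when multiplied by the measure of the unit ball.\<close>

lemma lborel_distr_linear_isometry:
  fixes f :: "'a::euclidean_space \<Rightarrow> 'a"
  assumes lin: "linear f" and iso: "\<And>x. norm (f x) = norm x"
  shows "distr lborel borel f = lborel"
proof (rule measure_eqI)
  have inj: "inj f"
    using lin iso by (metis linear_injective_0 norm_eq_zero)
  then obtain g where g: "\<And>y. f (g y) = y"
    using linear_injective_imp_surjective[OF lin] by (metis surjD)
  have cont: "continuous_on UNIV f"
    using lin linear_continuous_on linear_conv_bounded_linear by blast
  have f[measurable]: "f \<in> borel_measurable borel"
    by (rule borel_measurable_continuous_onI[OF cont])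
  show "sets (distr lborel borel f) = sets (lborel :: 'a measure)" by simp
  fix A :: "'a set" assume "A \<in> sets (distr lborel borel f)"
  then have A[measurable]: "A \<in> sets borel" by simp
  let ?B = "ball (0::'a) 1"
  let ?a = "indicator A :: 'a \<Rightarrow> ennreal"
  define b where "b = (indicator ?B :: 'a \<Rightarrow> ennreal)"
  have b[measurable]: "b \<in> borel_measurable borel" unfolding b_def by (intro borel_measurable_indicator borel_open open_ball)
  \<comment> \<open>Shifting x by a preimage \<open>g y\<close> of y turns \<open>f x\<close> into
    \<open>f x + y\<close>, so surjectivity of \<open>f\<close> lets translation invariance act
    inside \<open>f\<close>.\<close>
  have 1: "(\<integral>\<^sup>+x. ?a (f x) \<partial>lborel) * b y = (\<integral>\<^sup>+x. ?a (f x + y) * b y \<partial>lborel)" for y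
  proof -
    have "(\<integral>\<^sup>+x. ?a (f (g y + x)) \<partial>lborel) = (\<integral>\<^sup>+x. ?a (f x) \<partial>lborel)"
      by (rule nn_integral_lborel_translate[of "\<lambda>x. ?a (f x)"]) measurable
    then show ?thesis
      by (simp add: linear_add[OF lin] g add.commute nn_integral_multc)
  qed
  have 2: "(\<integral>\<^sup>+y. ?a (f x + y) * b y \<partial>lborel) = (\<integral>\<^sup>+y. ?a y * b (y - f x) \<partial>lborel)" for x
  proof -
    have "(\<lambda>y. ?a y * b (y - f x)) \<in> borel_measurable borel" by measurable
    from nn_integral_lborel_translate[OF this, of "f x"] show ?thesis by simp
  qed
  \<comment> \<open>The same shift gives y - f (g y + x) = - f x, whose norm is that of x: here the
    isometry enters.\<close>
  have 3: "(\<integral>\<^sup>+x. b (y - f x) \<partial>lborel) = emeasure lborel ?B" for y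
  proof -
    have "(\<integral>\<^sup>+x. b (y - f (g y + x)) \<partial>lborel) = (\<integral>\<^sup>+x. b (y - f x) \<partial>lborel)"
      by (rule nn_integral_lborel_translate[of "\<lambda>x. b (y - f x)"]) measurable
    moreover have "b (y - f (g y + x)) = b x" for x
      by (simp add: linear_add[OF lin] g iso b_def indicator_def)
    ultimately show ?thesis by (simp add: b_def)
  qed
  have "emeasure (distr lborel borel f) A * emeasure lborel ?B
      = (\<integral>\<^sup>+y. (\<integral>\<^sup>+x. ?a (f x) \<partial>lborel) * b y \<partial>lborel)"
  proof -
    have "emeasure (distr lborel borel f) A = (\<integral>\<^sup>+x. ?a x \<partial>distr lborel borel f)"
      by (rule nn_integral_indicator[symmetric]) simp
    also have "\<dots> = (\<integral>\<^sup>+x. ?a (f x) \<partial>lborel)"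
      by (rule nn_integral_distr) measurable
    finally show ?thesis
      by (simp add: nn_integral_cmult_indicator b_def)
  qed
  also have "\<dots> = (\<integral>\<^sup>+y. (\<integral>\<^sup>+x. ?a (f x + y) * b y \<partial>lborel) \<partial>lborel)"
    by (simp only: 1)
  also have "\<dots> = (\<integral>\<^sup>+x. (\<integral>\<^sup>+y. ?a (f x + y) * b y \<partial>lborel) \<partial>lborel)"
    by (rule lborel_pair.Fubini') measurable
  also have "\<dots> = (\<integral>\<^sup>+x. (\<integral>\<^sup>+y. ?a y * b (y - f x) \<partial>lborel) \<partial>lborel)"
    by (simp only: 2)
  also have "\<dots> = (\<integral>\<^sup>+y. (\<integral>\<^sup>+x. ?a y * b (y - f x) \<partial>lborel) \<partial>lborel)"
    by (rule lborel_pair.Fubini') measurable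
  also have "\<dots> = emeasure lborel A * emeasure lborel ?B"
    by (simp add: nn_integral_cmult 3 nn_integral_multc)
  finally have eq: "emeasure (distr lborel borel f) A * emeasure lborel ?B
      = emeasure lborel A * emeasure lborel ?B" .
  \<comment> \<open>The common factor can be cancelled in \<open>ennreal\<close> only because it is
    finite and nonzero.\<close>
  have "emeasure lborel ?B < \<infinity>"
    by (rule emeasure_bounded_finite) simp
  moreover have "emeasure lborel ?B \<noteq> 0"
    using content_ball_pos[of 1 "0::'a"] by (auto simp: measure_def)
  ultimately show "emeasure (distr lborel borel f) A = emeasure lborel A"
    using eq ennreal_mult_cancel_left[of "emeasure lborel ?B"] by (auto simp: mult.commute[of _ "emeasure lborel ?B"])
qed

lemma has_bochner_integral_gaussian_moment:
  fixes c :: real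
  assumes c: "0 < c"
  shows "has_bochner_integral lborel (\<lambda>x. exp (- c * x\<^sup>2)) (sqrt (pi / c))" (is ?A)
    and "has_bochner_integral lborel (\<lambda>x. x\<^sup>2 * exp (- c * x\<^sup>2)) (sqrt (pi / c) / (2 * c))" (is ?B)
proof -
  \<comment> \<open>Standard deviation of the normal law whose density is proportional to exp(-c
    x^2).\<close>
  define s where "s = sqrt (1 / (2 * c))"
  have s: "0 < s" "s\<^sup>2 = 1 / (2 * c)" using c by (auto simp: s_def)
  have nd: "normal_density 0 s x = exp (- c * x\<^sup>2) / sqrt (pi / c)" for x
    using c by (simp add: normal_density_def s field_simps)
  have pc: "sqrt (pi / c) \<noteq> 0" using c by simp
  show ?A
    using has_bochner_integral_mult_right[OF normal_moment_even[OF s(1), of 0 0], of "sqrt (pi/c)"] pc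
    by (simp add: nd)
  show ?B
    using has_bochner_integral_mult_right[OF normal_moment_even[OF s(1), of 0 1], of "sqrt (pi/c)"] pc c
    by (simp add: nd s fact_numeral mult.commute)
qed

text \<open>For nonnegative factors the product formula for \<open>nn_integral\<close> yields
  integrability and the value together, so no separate integrability argument is needed on the
  product space.\<close>

lemma has_bochner_integral_lborel_prod:
  fixes f :: "'a::euclidean_space \<Rightarrow> real \<Rightarrow> real"
  assumes f: "\<And>b. b \<in> Basis \<Longrightarrow> has_bochner_integral lborel (f b) (I b)"
    and nonneg: "\<And>b x. b \<in> Basis \<Longrightarrow> 0 \<le> f b x"
  shows "has_bochner_integral lborel (\<lambda>x::'a. \<Prod>b\<in>Basis. f b (x \<bullet> b)) (\<Prod>b\<in>Basis. I b)"
proof -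
  have m[measurable]: "f b \<in> borel_measurable borel" if "b \<in> Basis" for b
    using f[OF that] by (auto simp: has_bochner_integral_iff dest: borel_measurable_integrable)
  have I: "0 \<le> I b" if "b \<in> Basis" for b
  proof -
    have "0 \<le> integral\<^sup>L lborel (f b)" using nonneg[OF that] by simp
    then show ?thesis using f[OF that] by (simp add: has_bochner_integral_iff)
  qed
  have nn: "(\<integral>\<^sup>+x. f b x \<partial>lborel) = ennreal (I b)" if "b \<in> Basis" for b
    using f[OF that] nonneg[OF that] by (auto simp: has_bochner_integral_iff nn_integral_eq_integral)
  show ?thesis
  proof (rule has_bochner_integral_nn_integral)
    show "(\<lambda>x::'a. \<Prod>b\<in>Basis. f b (x \<bullet> b)) \<in> borel_measurable lborel"
      by measurable
    show "AE x::'a in lborel. 0 \<le> (\<Prod>b\<in>Basis. f b (x \<bullet> b))"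
      by (auto intro!: prod_nonneg nonneg)
    show "0 \<le> (\<Prod>b\<in>Basis. I b)"
      by (auto intro!: prod_nonneg I)
    have "(\<integral>\<^sup>+ x. ennreal (\<Prod>b\<in>Basis. f b (x \<bullet> b)) \<partial>lborel)
        = (\<integral>\<^sup>+ x. (\<Prod>b\<in>Basis. ennreal (f b (x \<bullet> b))) \<partial>lborel)"
      by (intro nn_integral_cong) (simp add: prod_ennreal nonneg)
    also have "\<dots> = (\<Prod>b\<in>Basis. (\<integral>\<^sup>+ x. ennreal (f b x) \<partial>lborel))"
      by (rule nn_integral_lborel_prod) (auto simp: m)
    also have "\<dots> = ennreal (\<Prod>b\<in>Basis. I b)"
      by (simp add: nn prod_ennreal I)
    finally show "(\<integral>\<^sup>+ x. ennreal (\<Prod>b\<in>Basis. f b (x \<bullet> b)) \<partial>lborel) = ennreal (\<Prod>b\<in>Basis. I b)" .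
  qed
qed

lemma exp_norm_prod:
  "exp (- c * (norm (x::'a::euclidean_space))\<^sup>2) = (\<Prod>b\<in>Basis. exp (- c * (x \<bullet> b)\<^sup>2))"
proof -
  have "(norm x)\<^sup>2 = (\<Sum>b\<in>Basis. (x \<bullet> b)\<^sup>2)"
    by (subst power2_norm_eq_inner, subst euclidean_inner) (simp add: power2_eq_square)
  then show ?thesis by (simp add: exp_sum sum_distrib_left flip: sum_negf)
qed

lemma has_bochner_integral_gaussian:
  assumes "0 < c"
  shows "has_bochner_integral lborel (\<lambda>x::'a::euclidean_space. exp (- c * (norm x)\<^sup>2))
    (sqrt (pi / c) ^ DIM('a))"
  using has_bochner_integral_lborel_prod[of "\<lambda>(_::'a) x. exp (- c * x\<^sup>2)" "\<lambda>_. sqrt (pi / c)"]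
    has_bochner_integral_gaussian_moment(1)[OF assms]
  unfolding exp_norm_prod by simp

lemma has_bochner_integral_gaussian_square:
  fixes b :: "'a::euclidean_space"
  assumes "0 < c" and b: "b \<in> Basis"
  shows "has_bochner_integral lborel (\<lambda>x. (x \<bullet> b)\<^sup>2 * exp (- c * (norm x)\<^sup>2))
    (sqrt (pi / c) ^ DIM('a) / (2 * c))"
proof -
  \<comment> \<open>The second moment is inserted in the single coordinate \<open>b\<close>; all
    other factors stay plain Gaussians, which gives the one extra factor 1 / (2c).\<close>
  let ?f = "\<lambda>b' x. (if b' = b then x\<^sup>2 else 1) * exp (- c * x\<^sup>2)"
  let ?I = "\<lambda>b'. sqrt (pi / c) * (if b' = b then 1 / (2 * c) else 1)"
  have "has_bochner_integral lborel (\<lambda>x::'a. \<Prod>b'\<in>Basis. ?f b' (x \<bullet> b')) (\<Prod>b'\<in>(Basis::'a set). ?I b')"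
    using has_bochner_integral_gaussian_moment[OF assms(1)]
    by (intro has_bochner_integral_lborel_prod) auto
  moreover have "(\<Prod>b'\<in>Basis. ?f b' (x \<bullet> b')) = (x \<bullet> b)\<^sup>2 * exp (- c * (norm x)\<^sup>2)" for x
    unfolding exp_norm_prod prod.distrib using b by (subst prod.delta) auto
  moreover have "(\<Prod>b'\<in>(Basis::'a set). ?I b') = sqrt (pi / c) ^ DIM('a) / (2 * c)"
    unfolding prod.distrib using b by (subst prod.delta) auto
  ultimately show ?thesis by simp
qed

lemma integrable_gaussian_exp_linear:
  assumes "0 < c"
  shows "integrable lborel (\<lambda>x::'a::euclidean_space. exp (K * norm x - c * (norm x)\<^sup>2))"
proof (rule Bochner_Integration.integrable_bound)
  show "integrable lborel (\<lambda>x::'a. exp (K\<^sup>2 / (2 * c)) * exp (- (c / 2) * (norm x)\<^sup>2))"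
    using has_bochner_integral_gaussian[of "c/2", where 'a='a] assms
    by (intro integrable_mult_right) (auto simp: has_bochner_integral_iff)
  show "(\<lambda>x::'a. exp (K * norm x - c * (norm x)\<^sup>2)) \<in> borel_measurable lborel" by measurable
  \<comment> \<open>Completing the square: half of the Gaussian absorbs the linear term at the price
    of a constant.\<close>
  have "K * r - c * r\<^sup>2 \<le> K\<^sup>2 / (2 * c) - c / 2 * r\<^sup>2" for r
  proof -
    have "0 \<le> (K - c * r)\<^sup>2 / (2 * c)" using assms by simp
    also have "\<dots> = K\<^sup>2 / (2 * c) - c / 2 * r\<^sup>2 - (K * r - c * r\<^sup>2)"
      using assms by (simp add: power2_eq_square field_simps)
    finally show ?thesis by simp
  qed
  then show "AE x::'a in lborel. norm (exp (K * norm x - c * (norm x)\<^sup>2))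
      \<le> norm (exp (K\<^sup>2 / (2 * c)) * exp (- (c / 2) * (norm x)\<^sup>2))"
    by (auto simp flip: exp_add)
qed

subsection \<open>Gaussian measures on complex vector space\<close>

lemma norm_scalar_mult_complex:
  fixes w :: "complex ^ 'n"
  shows "norm (u *s w) = cmod u * norm w"
  by (simp add: norm_vec_def norm_mult L2_set_right_distrib)

lemma linear_scalar_mult_complex: "linear (\<lambda>w :: complex ^ 'n. u *s w)"
  by (rule linearI) (simp_all add: vec_eq_iff algebra_simps)

lemma norm_bil_le: "cmod (z \<odot> w) \<le> norm z * norm w"
proof -
  have "cmod (z \<odot> w) \<le> (\<Sum>j\<in>UNIV. \<bar>cmod (z $ j)\<bar> * \<bar>cmod (w $ j)\<bar>)"
    unfolding bil_def by (rule order_trans[OF norm_sum]) (simp add: norm_mult)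
  also have "\<dots> \<le> norm z * norm w"
    unfolding norm_vec_def by (rule L2_set_mult_ineq)
  finally show ?thesis .
qed

lemma bil_simps:
  "(x + y) \<odot> z = x \<odot> z + y \<odot> z" "z \<odot> (x + y) = z \<odot> x + z \<odot> y"
  "(x - y) \<odot> z = x \<odot> z - y \<odot> z" "z \<odot> (x - y) = z \<odot> x - z \<odot> y"
  "(u *s x) \<odot> z = u * (x \<odot> z)" "z \<odot> (u *s x) = u * (z \<odot> x)"
  "(r *\<^sub>R x) \<odot> z = r *\<^sub>R (x \<odot> z)" "z \<odot> (r *\<^sub>R x) = r *\<^sub>R (z \<odot> x)"
  "(- x) \<odot> z = - (x \<odot> z)" "z \<odot> (- x) = - (z \<odot> x)" "0 \<odot> z = 0" "z \<odot> 0 = 0"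
  by (simp_all add: bil_def sum.distrib sum_subtractf sum_negf algebra_simps sum_distrib_left
      scaleR_sum_right)

lemma bil_commute: "x \<odot> y = y \<odot> x"
  by (simp add: bil_def mult.commute)

lemma bounded_bilinear_bil: "bounded_bilinear (\<odot>)"
  by (rule bounded_bilinear.intro)
    (use norm_bil_le in \<open>auto simp: bil_simps intro!: exI[of _ 1]\<close>)

lemma vcnj_simps:
  "vcnj (x + y) = vcnj x + vcnj y" "vcnj (x - y) = vcnj x - vcnj y" "vcnj (- x) = - vcnj x"
  "vcnj (u *s x) = cnj u *s vcnj x" "vcnj (r *\<^sub>R x) = r *\<^sub>R vcnj x"
  "vcnj 0 = 0" "vcnj (vcnj x) = x"
  by (simp_all add: vcnj_def vec_eq_iff)

lemma norm_vcnj: "norm (vcnj x) = norm x"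
  by (simp add: vcnj_def norm_vec_def)

lemma bounded_linear_vcnj: "bounded_linear vcnj"
  by (rule bounded_linear_intro[of _ 1]) (simp_all add: vcnj_simps norm_vcnj)

lemma bil_vcnj_self: "w \<odot> vcnj w = of_real ((norm w)\<^sup>2)"
proof -
  have "(norm w)\<^sup>2 = (\<Sum>j\<in>UNIV. (cmod (w $ j))\<^sup>2)"
    by (simp add: norm_vec_def L2_set_def sum_nonneg)
  then show ?thesis
    by (simp only: of_real_sum complex_norm_square) (simp add: bil_def vcnj_def)
qed

lemma bounded_bilinear_matrix_vector: "bounded_bilinear (\<lambda>(M :: complex ^ 'n ^ 'm) v. M *v v)"
  unfolding bilinear_conv_bounded_bilinear[symmetric] bilinear_def
  by (auto intro!: linearI simp: matrix_vector_mult_def vec_eq_iff algebra_simps sum.distrib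
      scaleR_sum_right)

lemma bounded_bilinear_matrix_matrix:
  "bounded_bilinear (\<lambda>(M :: complex ^ 'n ^ 'm) (N :: complex ^ 'k ^ 'n). M ** N)"
  unfolding bilinear_conv_bounded_bilinear[symmetric] bilinear_def
  by (auto intro!: linearI simp: matrix_matrix_mult_def vec_eq_iff algebra_simps sum.distrib
      scaleR_sum_right)

lemmas [continuous_intros] =
  bounded_bilinear.continuous_on[OF bounded_bilinear_bil]
  bounded_bilinear.continuous_on[OF bounded_bilinear_matrix_vector]
  bounded_linear.continuous_on[OF bounded_linear_vcnj]

lemma matrix_vector_scalar_complex: "(M :: complex ^ 'n ^ 'm) *v (u *s v) = u *s (M *v v)"
  by (simp add: matrix_vector_mult_def vec_eq_iff sum_distrib_left algebra_simps)

text \<open>A probability measure: the real dimension is 2n, so the mass (pi/c)^(2n/2) gives the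
  exponent n of the normalising factor. The width c stays a parameter because two values occur,
  lam/2 for the Fock weight and lam for the Weyl integral.\<close>

definition gaussian :: "real \<Rightarrow> (complex ^ 'n) measure" where
  "gaussian c = density lborel (\<lambda>w. ennreal ((c / pi) ^ CARD('n) * exp (- c * (norm w)\<^sup>2)))"

lemma sets_gaussian[measurable_cong]: "sets (gaussian c) = sets borel"
  by (simp add: gaussian_def)

context
  fixes c :: real
  assumes c: "0 < c"
begin

lemma gaussian_integral_iff:
  fixes h :: "complex ^ 'n \<Rightarrow> 'b::{banach, second_countable_topology}"
  assumes h: "h \<in> borel_measurable borel"
  shows "(\<integral>w. h w \<partial>gaussian c)
      = (\<integral>w. ((c / pi) ^ CARD('n) * exp (- c * (norm w)\<^sup>2)) *\<^sub>R h w \<partial>lborel)" (is ?int)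
    and "integrable (gaussian c) h \<longleftrightarrow>
      integrable lborel (\<lambda>w. ((c / pi) ^ CARD('n) * exp (- c * (norm w)\<^sup>2)) *\<^sub>R h w)" (is ?iff)
proof -
  have m: "(\<lambda>w::complex^'n. (c / pi) ^ CARD('n) * exp (- c * (norm w)\<^sup>2)) \<in> borel_measurable lborel"
    by measurable
  show ?int unfolding gaussian_def using c h m by (intro integral_density) auto
  show ?iff unfolding gaussian_def using c h m by (intro integrable_density) auto
qed

lemma integral_gaussian_one: "integral\<^sup>L (gaussian c :: (complex ^ 'n) measure) (\<lambda>_. 1 :: complex) = 1"
proof -
  have s: "sqrt (pi / c) ^ (2 * k) = (pi / c) ^ k" for k
    using c by (simp add: power_mult)
  have "(\<integral>w. (c / pi) ^ CARD('n) * exp (- c * (norm (w :: complex ^ 'n))\<^sup>2) \<partial>lborel)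
      = (c / pi) ^ CARD('n) * (sqrt (pi / c) ^ DIM(complex ^ 'n))"
    using has_bochner_integral_gaussian[OF c, where 'a="complex ^ 'n"]
    by (simp add: has_bochner_integral_iff)
  also have "\<dots> = 1"
    using c by (simp add: mult.commute[of _ 2] s flip: power_mult_distrib)
  finally have "(\<integral>w. complex_of_real ((c / pi) ^ CARD('n) * exp (- c * (norm (w :: complex ^ 'n))\<^sup>2)) \<partial>lborel) = 1"
    by (simp only: integral_complex_of_real of_real_1)
  then show ?thesis
    by (subst gaussian_integral_iff) (simp_all only: scaleR_conv_of_real mult_1_right borel_measurable_const)
qed

lemma integrable_gaussian_exp_norm:
  assumes "d < c"
  shows "integrable (gaussian c) (\<lambda>w::complex ^ 'n. exp (K * norm w + d * (norm w)\<^sup>2))"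
proof -
  have "integrable lborel (\<lambda>w::complex ^ 'n. (c / pi) ^ CARD('n) * exp (K * norm w - (c - d) * (norm w)\<^sup>2))"
    using assms by (intro integrable_mult_right integrable_gaussian_exp_linear) simp
  also have "(\<lambda>w::complex ^ 'n. (c / pi) ^ CARD('n) * exp (K * norm w - (c - d) * (norm w)\<^sup>2))
    = (\<lambda>w. ((c / pi) ^ CARD('n) * exp (- c * (norm w)\<^sup>2)) *\<^sub>R exp (K * norm w + d * (norm w)\<^sup>2))"
    by (auto simp: fun_eq_iff algebra_simps simp flip: exp_add)
  finally show ?thesis
    by (subst gaussian_integral_iff) auto
qed

lemma integral_gaussian_isometry:
  fixes h :: "complex ^ 'n \<Rightarrow> complex" and f :: "complex ^ 'n \<Rightarrow> complex ^ 'n"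
  assumes h: "h \<in> borel_measurable borel"
    and lin: "linear f" and iso: "\<And>w. norm (f w) = norm w"
  shows "(\<integral>w. h (f w) \<partial>gaussian c) = (\<integral>w. h w \<partial>gaussian c)"
proof -
  have "continuous_on UNIV f"
    using lin linear_continuous_on linear_conv_bounded_linear by blast
  then have f[measurable]: "f \<in> borel_measurable borel"
    by (rule borel_measurable_continuous_onI)
  note h[measurable]
  let ?g = "\<lambda>w. ((c / pi) ^ CARD('n) * exp (- c * (norm w)\<^sup>2)) *\<^sub>R h w"
  have "(\<integral>w. h w \<partial>gaussian c) = (\<integral>w. ?g w \<partial>distr lborel borel f)"
    using iso by (simp add: gaussian_integral_iff lborel_distr_linear_isometry[OF lin])
  also have "\<dots> = (\<integral>w. ?g (f w) \<partial>lborel)"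
    by (rule integral_distr) measurable
  also have "\<dots> = (\<integral>w. h (f w) \<partial>gaussian c)"
    by (simp add: gaussian_integral_iff iso)
  finally show ?thesis by simp
qed

text \<open>The change of variables shows that the integral equals its own negative. It is valid for
  every measurable function, a nonintegrable one having Bochner integral 0.\<close>

lemma integral_gaussian_twisted_eq_0:
  fixes h :: "complex ^ 'n \<Rightarrow> complex"
  assumes h: "h \<in> borel_measurable borel"
    and lin: "linear f" and iso: "\<And>w. norm (f w) = norm w"
    and twist: "\<And>w. h (f w) = - h w"
  shows "(\<integral>w. h w \<partial>gaussian c) = 0"
  using integral_gaussian_isometry[OF h lin iso] by (simp add: twist)

lemma integral_gaussian_antiholo_homogeneous_eq_0:
  fixes h :: "complex ^ 'n \<Rightarrow> complex"
  assumes h: "h \<in> borel_measurable borel"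
    and hom: "\<And>u w. cmod u = 1 \<Longrightarrow> h (u *s w) = cnj u ^ d * h w" and d: "0 < d"
  shows "(\<integral>w. h w \<partial>gaussian c) = 0"
proof (rule integral_gaussian_twisted_eq_0[OF h])
  \<comment> \<open>A rotation with u^d = -1, which reverses the sign of a function of degree
    d.\<close>
  let ?u = "cis (pi / d)"
  show "linear (\<lambda>w::complex^'n. ?u *s w)" by (rule linear_scalar_mult_complex)
  show "norm (?u *s w) = norm w" for w :: "complex ^ 'n" by (simp add: norm_scalar_mult_complex)
  have "cnj ?u ^ d = cnj (?u ^ d)" by simp
  also have "\<dots> = -1" using d by (simp only: Complex.DeMoivre) simp
  finally have "cnj ?u ^ d = -1" .
  then show "h (?u *s w) = - h w" for w by (simp add: hom)
qed

end

text \<open>The index set is arbitrary because two kinds occur: a singleton bounds one monomial by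
  the exponential, an initial segment dominates the partial sums uniformly.\<close>

lemma exp_partial_sum_le:
  fixes x :: real
  assumes "0 \<le> x"
  shows "(\<Sum>m\<in>I. x ^ m / fact m) \<le> exp x"
proof (cases "finite I")
  case True
  have "(\<Sum>m\<in>I. x ^ m / fact m) \<le> (\<Sum>m. x ^ m / fact m)"
    using assms True summable_exp_generic[of x]
    by (intro sum_le_suminf) (auto simp: divide_inverse mult.commute)
  then show ?thesis by (simp add: exp_def divide_inverse mult.commute)
\<comment> \<open>Over an infinite index set the sum is 0 by default.\<close>
qed simp

text \<open>Only the constant term of the exponential series survives, since all other terms are sums of
  functions that are homogeneous of positive degree in the conjugate variable.\<close>

lemma integral_gaussian_exp_antiholo:
  fixes \<alpha> \<beta> :: "complex ^ 'n \<Rightarrow> complex"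
  assumes c: "0 < c"
    and \<alpha>: "\<alpha> \<in> borel_measurable borel" and \<beta>: "\<beta> \<in> borel_measurable borel"
    and hom1: "\<And>u w. cmod u = 1 \<Longrightarrow> \<alpha> (u *s w) = cnj u * \<alpha> w"
    and hom2: "\<And>u w. cmod u = 1 \<Longrightarrow> \<beta> (u *s w) = (cnj u)\<^sup>2 * \<beta> w"
    and int: "integrable (gaussian c) (\<lambda>w. exp (cmod (\<alpha> w) + cmod (\<beta> w)))"
  shows "(\<integral>w. exp (\<alpha> w + \<beta> w) \<partial>gaussian c) = 1"
proof -
  note [measurable] = \<alpha> \<beta>
  let ?E = "\<lambda>w. exp (cmod (\<alpha> w) + cmod (\<beta> w))"
  have mono_int: "integrable (gaussian c) (\<lambda>w. \<alpha> w ^ j * \<beta> w ^ l)" for j l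
  proof (rule Bochner_Integration.integrable_bound)
    show "integrable (gaussian c) (\<lambda>w. fact (j + l) * ?E w)"
      by (intro integrable_mult_right int)
    show "AE w in gaussian c. norm (\<alpha> w ^ j * \<beta> w ^ l) \<le> norm (fact (j + l) * ?E w)"
    proof (rule AE_I2)
      fix w
      let ?s = "cmod (\<alpha> w) + cmod (\<beta> w)"
      have "norm (\<alpha> w ^ j * \<beta> w ^ l) \<le> ?s ^ j * ?s ^ l"
        by (auto simp: norm_mult norm_power intro!: mult_mono power_mono)
      also have "\<dots> \<le> fact (j + l) * exp ?s"
        using exp_partial_sum_le[of ?s "{j + l}"] by (simp add: power_add field_simps)
      finally show "norm (\<alpha> w ^ j * \<beta> w ^ l) \<le> norm (fact (j + l) * ?E w)" by simp
    qed
  qed measurable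
  have mono_0: "(\<integral>w. \<alpha> w ^ j * \<beta> w ^ l \<partial>gaussian c) = 0" if "0 < j + l" for j l
  proof (rule integral_gaussian_antiholo_homogeneous_eq_0[OF c])
    \<comment> \<open>The factor \<beta> is of degree two in the conjugate variable, hence the total
      degree j + 2l, positive as soon as j + l is.\<close>
    show "\<alpha> (u *s w) ^ j * \<beta> (u *s w) ^ l = cnj u ^ (j + 2 * l) * (\<alpha> w ^ j * \<beta> w ^ l)"
      if "cmod u = 1" for u w
      using that by (simp add: hom1 hom2 power_mult_distrib power_add power_mult)
  qed (use that in \<open>auto\<close>)
  define s where "s N w = (\<Sum>m<N. (\<alpha> w + \<beta> w) ^ m / fact m)" for N w
  have s_alt: "s N w = (\<Sum>m<N. \<Sum>k\<le>m. (of_nat (m choose k) / fact m) * (\<alpha> w ^ k * \<beta> w ^ (m - k)))" for N w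
    unfolding s_def binomial_ring by (simp add: sum_divide_distrib mult.assoc)
  \<comment> \<open>\<open>Suc N\<close> ensures that the term m = 0 is present; the empty partial
    sum would integrate to 0.\<close>
  have int_s: "(\<integral>w. s (Suc N) w \<partial>gaussian c) = 1" for N
  proof -
    have "(\<integral>w. s (Suc N) w \<partial>gaussian c)
      = (\<Sum>m<Suc N. \<Sum>k\<le>m. (of_nat (m choose k) / fact m) * (\<integral>w. \<alpha> w ^ k * \<beta> w ^ (m - k) \<partial>gaussian c))"
      unfolding s_alt by (simp add: mono_int Bochner_Integration.integral_sum)
    also have "\<dots> = (\<Sum>m<Suc N. if m = 0 then 1 else 0)"
    proof (rule sum.cong[OF refl])
      fix m
      show "(\<Sum>k\<le>m. (of_nat (m choose k) / fact m) * (\<integral>w. \<alpha> w ^ k * \<beta> w ^ (m - k) \<partial>gaussian c))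
        = (if m = 0 then 1 else 0)"
        by (cases "m = 0") (use integral_gaussian_one[OF c, where 'n='n] in \<open>auto simp: mono_0\<close>)
    qed
    also have "\<dots> = 1" by (simp add: sum.delta)
    finally show ?thesis .
  qed
  \<comment> \<open>Dominated convergence, with the exponential of the absolute values as majorant
    for all N at once.\<close>
  have "(\<lambda>N. \<integral>w. s N w \<partial>gaussian c) \<longlonglongrightarrow> (\<integral>w. exp (\<alpha> w + \<beta> w) \<partial>gaussian c)"
  proof (rule integral_dominated_convergence[OF _ _ int])
    show "AE w in gaussian c. (\<lambda>N. s N w) \<longlonglongrightarrow> exp (\<alpha> w + \<beta> w)"
    proof (rule AE_I2)
      fix w
      have "(\<lambda>m. (\<alpha> w + \<beta> w) ^ m / fact m) sums exp (\<alpha> w + \<beta> w)"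
        using exp_converges[of "\<alpha> w + \<beta> w"] by (simp add: scaleR_conv_of_real divide_inverse mult.commute)
      then show "(\<lambda>N. s N w) \<longlonglongrightarrow> exp (\<alpha> w + \<beta> w)" by (simp add: sums_def s_def)
    qed
    show "AE w in gaussian c. norm (s N w) \<le> ?E w" for N
    proof (rule AE_I2)
      fix w
      let ?s = "cmod (\<alpha> w) + cmod (\<beta> w)"
      have "norm (s N w) \<le> (\<Sum>m<N. ?s ^ m / fact m)"
        unfolding s_def
        by (rule order_trans[OF norm_sum])
          (auto simp: norm_divide norm_power intro!: sum_mono divide_right_mono power_mono norm_triangle_ineq)
      also have "\<dots> \<le> ?E w" by (rule exp_partial_sum_le) simp
      finally show "norm (s N w) \<le> ?E w" .
    qed
    show "s N \<in> borel_measurable (gaussian c)" for N unfolding s_def by measurable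
  qed measurable
  then have "(\<lambda>N. \<integral>w. s (Suc N) w \<partial>gaussian c) \<longlonglongrightarrow> (\<integral>w. exp (\<alpha> w + \<beta> w) \<partial>gaussian c)"
    by (rule LIMSEQ_Suc)
  then have "(\<lambda>N. 1) \<longlonglongrightarrow> (\<integral>w. exp (\<alpha> w + \<beta> w) \<partial>gaussian c)"
    by (simp only: int_s)
  then show ?thesis
    using LIMSEQ_unique[OF tendsto_const] by metis
qed

section \<open>Gaussian moments of degree at most two\<close>

lemma integrable_gaussian_poly:
  fixes h :: "complex ^ 'n \<Rightarrow> complex"
  assumes c: "0 < c" and h: "continuous_on UNIV h"
    and le: "\<And>w. cmod (h w) \<le> C * (1 + norm w)\<^sup>2"
  shows "integrable (gaussian c) h"
proof (rule Bochner_Integration.integrable_bound)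
  have h[measurable]: "h \<in> borel_measurable borel" by (rule borel_measurable_continuous_onI[OF h])
  then show "h \<in> borel_measurable (gaussian c)" by measurable
  show "integrable (gaussian c) (\<lambda>w::complex^'n. \<bar>C\<bar> * exp (2 * norm w + 0 * (norm w)\<^sup>2))"
    by (intro integrable_mult_right integrable_gaussian_exp_norm c)
  show "AE w in gaussian c. norm (h w) \<le> norm (\<bar>C\<bar> * exp (2 * norm w + 0 * (norm w)\<^sup>2))"
  proof (rule AE_I2)
    fix w :: "complex ^ 'n"
    have "(1 + norm w)\<^sup>2 \<le> (exp (norm w))\<^sup>2"
      using exp_ge_add_one_self[of "norm w"] by (intro power_mono) auto
    also have "\<dots> = exp (2 * norm w)" by (simp flip: exp_double)
    finally have "C * (1 + norm w)\<^sup>2 \<le> \<bar>C\<bar> * exp (2 * norm w)"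
      by (intro mult_mono) auto
    then show "norm (h w) \<le> norm (\<bar>C\<bar> * exp (2 * norm w + 0 * (norm w)\<^sup>2))"
      using le[of w] by simp
  qed
qed

lemma integrable_gaussian_linear:
  assumes c: "0 < c" and h: "bounded_linear (h :: complex ^ 'n \<Rightarrow> complex)"
  shows "integrable (gaussian c) h"
proof -
  obtain K where K: "\<And>w. norm (h w) \<le> norm w * K" and K0: "0 < K"
    using bounded_linear.pos_bounded[OF h] by blast
  have "r * K \<le> K * (1 + r)\<^sup>2" if "0 \<le> r" for r :: real
    using that K0 by (simp add: power2_eq_square algebra_simps)
  then show ?thesis
    using K by (intro integrable_gaussian_poly[OF c linear_continuous_on[OF h], of K])
      (meson norm_ge_zero order_trans)
qed

lemma integrable_gaussian_bilinear:
  assumes c: "0 < c" and b: "bounded_bilinear (b :: complex ^ 'n \<Rightarrow> complex ^ 'n \<Rightarrow> complex)"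
  shows "integrable (gaussian c) (\<lambda>w. b w w)"
proof -
  obtain K where K: "\<And>v w. norm (b v w) \<le> norm v * norm w * K" and K0: "0 < K"
    using bounded_bilinear.pos_bounded[OF b] by blast
  have "r * r * K \<le> K * (1 + r)\<^sup>2" if "0 \<le> r" for r :: real
    using that K0 by (simp add: power2_eq_square algebra_simps)
  then show ?thesis
    using K by (intro integrable_gaussian_poly[OF c _, of _ K]
        bounded_bilinear.continuous_on[OF b] continuous_intros)
      (meson norm_ge_zero order_trans)
qed

lemma integral_gaussian_linear:
  assumes c: "0 < c" and h: "bounded_linear (h :: complex ^ 'n \<Rightarrow> complex)"
  shows "(\<integral>w. h w \<partial>gaussian c) = 0"
proof (rule integral_gaussian_twisted_eq_0[OF c, where f = uminus])
  show "h \<in> borel_measurable borel"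
    by (rule borel_measurable_continuous_onI[OF linear_continuous_on[OF h]])
qed (auto intro: linear_uminus simp: linear_neg[OF bounded_linear.linear[OF h]])

text \<open>Rotation by the imaginary unit treats holomorphic and antiholomorphic quadratic forms
  alike, as i and its conjugate both square to -1. Mixed forms are invariant under it and
  escape.\<close>

lemma integral_gaussian_bilinear:
  assumes c: "0 < c" and b: "bounded_bilinear (b :: complex ^ 'n \<Rightarrow> complex ^ 'n \<Rightarrow> complex)"
    and twist: "\<And>w. b (\<i> *s w) (\<i> *s w) = - b w w"
  shows "(\<integral>w. b w w \<partial>gaussian c) = 0"
proof (rule integral_gaussian_twisted_eq_0[OF c, where f = "\<lambda>w. \<i> *s w"])
  show "(\<lambda>w. b w w) \<in> borel_measurable borel"
    by (intro borel_measurable_continuous_onI bounded_bilinear.continuous_on[OF b] continuous_intros)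
qed (simp_all add: linear_scalar_mult_complex norm_scalar_mult_complex twist)

lemma integral_gaussian_covariance:
  fixes j k :: "'n::finite"
  assumes c: "0 < c"
  shows "(\<integral>w. w $ k * cnj (w $ j) \<partial>gaussian c) = (if j = k then 1 / of_real c else 0)"
proof (cases "j = k")
  case False
  \<comment> \<open>Reflecting the single coordinate j preserves the norm and reverses the sign of
    the product.\<close>
  let ?f = "\<lambda>w :: complex ^ 'n. \<chi> i. if i = j then - w $ i else w $ i"
  have "(\<integral>w. w $ k * cnj (w $ j) \<partial>gaussian c) = 0"
  proof (rule integral_gaussian_twisted_eq_0[OF c, where f = ?f])
    show "linear ?f" by (rule linearI) (auto simp: vec_eq_iff)
    show "norm (?f w) = norm w" for w
      unfolding norm_vec_def by (rule arg_cong2[where f=L2_set]) auto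
    show "(\<lambda>w::complex^'n. w $ k * cnj (w $ j)) \<in> borel_measurable borel"
      by (intro borel_measurable_continuous_onI continuous_intros)
  qed (use False in auto)
  then show ?thesis using False by simp
next
  case True
  let ?c = "(c / pi) ^ CARD('n)"
  have s: "sqrt (pi / c) ^ (2 * m) = (pi / c) ^ m" for m
    using c by (simp add: power_mult)
  have cs: "?c * sqrt (pi / c) ^ DIM(complex ^ 'n) = 1"
    using c by (simp add: mult.commute[of _ 2] s flip: power_mult_distrib)
  \<comment> \<open>The squared modulus of a coordinate is the sum of the squares of two real
    coordinates, each of variance 1 / (2c).\<close>
  have sq: "w $ k * cnj (w $ k) = of_real ((w \<bullet> axis k 1)\<^sup>2 + (w \<bullet> axis k \<i>)\<^sup>2)" for w :: "complex ^ 'n"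
    by (simp add: inner_axis complex_mult_cnj)
  have B: "axis k 1 \<in> (Basis :: (complex ^ 'n) set)" "axis k \<i> \<in> (Basis :: (complex ^ 'n) set)"
    by (auto simp: Basis_complex_def axis_in_Basis_iff)
  have "has_bochner_integral lborel
      (\<lambda>w::complex ^ 'n. ?c * ((w \<bullet> axis k 1)\<^sup>2 * exp (- c * (norm w)\<^sup>2) + (w \<bullet> axis k \<i>)\<^sup>2 * exp (- c * (norm w)\<^sup>2)))
      (?c * (sqrt (pi / c) ^ DIM(complex ^ 'n) / (2 * c) + sqrt (pi / c) ^ DIM(complex ^ 'n) / (2 * c)))"
    by (intro has_bochner_integral_mult_right has_bochner_integral_add
        has_bochner_integral_gaussian_square c B)
  also have "?c * (sqrt (pi / c) ^ DIM(complex ^ 'n) / (2 * c) + sqrt (pi / c) ^ DIM(complex ^ 'n) / (2 * c)) = 1 / c"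
    using cs c by (simp add: field_simps)
  finally have "has_bochner_integral lborel (\<lambda>w::complex ^ 'n.
      complex_of_real (?c * ((w \<bullet> axis k 1)\<^sup>2 * exp (- c * (norm w)\<^sup>2) + (w \<bullet> axis k \<i>)\<^sup>2 * exp (- c * (norm w)\<^sup>2))))
      (of_real (1 / c))"
    by (rule has_bochner_integral_of_real)
  note moment = this
  have m: "(\<lambda>w::complex^'n. w $ k * cnj (w $ k)) \<in> borel_measurable borel"
    by (intro borel_measurable_continuous_onI continuous_intros)
  have "(\<integral>w. w $ k * cnj (w $ k) \<partial>gaussian c) = (\<integral>w.
      complex_of_real (?c * ((w \<bullet> axis k 1)\<^sup>2 * exp (- c * (norm w)\<^sup>2) + (w \<bullet> axis k \<i>)\<^sup>2 * exp (- c * (norm w)\<^sup>2))) \<partial>lborel)"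
    unfolding gaussian_integral_iff(1)[OF c m]
    by (intro Bochner_Integration.integral_cong refl) (simp add: sq scaleR_conv_of_real algebra_simps)
  also have "\<dots> = 1 / of_real c"
    using moment by (simp only: has_bochner_integral_iff of_real_divide of_real_1)
  finally have "(\<integral>w. w $ k * cnj (w $ k) \<partial>gaussian c) = 1 / of_real c" .
  then show ?thesis using True by simp
qed

lemma integral_gaussian_sesquilinear:
  fixes M :: "complex ^ 'n ^ 'n"
  assumes c: "0 < c"
  shows "(\<integral>w. (M *v w) \<odot> vcnj w \<partial>gaussian c) = trace M / of_real c"
proof -
  have int: "integrable (gaussian c) (\<lambda>w. w $ k * cnj (w $ j))" for j k :: 'n
    by (rule integrable_gaussian_bilinear[OF c, of "\<lambda>v w. v $ k * cnj (w $ j)"])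
      (intro bounded_bilinear.comp[OF bounded_bilinear_mult] bounded_linear_vec_nth
        bounded_linear_compose[OF bounded_linear_cnj])
  have "(M *v w) \<odot> vcnj w = (\<Sum>j\<in>UNIV. \<Sum>k\<in>UNIV. M $ j $ k * (w $ k * cnj (w $ j)))" for w
    by (simp add: bil_def matrix_vector_mult_def vcnj_def sum_distrib_right mult.assoc)
  then have "(\<integral>w. (M *v w) \<odot> vcnj w \<partial>gaussian c)
      = (\<Sum>j\<in>UNIV. \<Sum>k\<in>UNIV. M $ j $ k * (if j = k then 1 / of_real c else 0))"
    by (simp add: int integral_gaussian_covariance[OF c] Bochner_Integration.integral_sum)
  also have "\<dots> = trace M / of_real c"
    by (simp add: trace_def sum_divide_distrib if_distrib cong: if_cong)
  finally show ?thesis .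
qed

text \<open>The only place where the normalisation of \<open>mu\<close> enters: the factor is 1 for
  c = lam/2 and 2^(-n) for c = lam.\<close>

lemma mu_eq_gaussian:
  fixes g :: "complex ^ 'n \<Rightarrow> complex"
  assumes c: "0 < c" and lam: "0 < lam" and g: "g \<in> borel_measurable borel"
  shows "(\<integral>w. g w * of_real (exp (- c * (norm w)\<^sup>2)) \<partial>mu lam)
      = of_real ((lam / (2 * c)) ^ CARD('n)) * (\<integral>w. g w \<partial>gaussian c)" (is ?int)
    and "integrable (gaussian c) g \<Longrightarrow>
      integrable (mu lam) (\<lambda>w. g w * of_real (exp (- c * (norm w)\<^sup>2)))" (is "_ \<Longrightarrow> ?iff")
proof -
  note [measurable] = g
  let ?m = "(lam / (2 * pi)) ^ CARD('n)"
  have m: "0 \<le> ?m" using lam by simp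
  have eq: "?m *\<^sub>R (g w * of_real (exp (- c * (norm w)\<^sup>2)))
      = of_real ((lam / (2 * c)) ^ CARD('n)) * (((c / pi) ^ CARD('n) * exp (- c * (norm w)\<^sup>2)) *\<^sub>R g w)" for w
    using c by (simp add: scaleR_conv_of_real power_divide power_mult_distrib)
  show ?int
    unfolding mu_def by (subst integral_density) (use m in \<open>simp_all only: eq gaussian_integral_iff(1)[OF c g] integral_mult_right_zero\<close>, simp_all)
  assume "integrable (gaussian c) g"
  then show ?iff
    unfolding mu_def by (subst integrable_density) (use m in \<open>simp_all only: eq gaussian_integral_iff(2)[OF c g] integrable_mult_right\<close>, simp_all)
qed

subsection \<open>Weyl symbols and the reproducing property\<close>

lemma of_real_norm_square: "(complex_of_real (norm w))\<^sup>2 = w \<odot> vcnj w"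
  by (simp add: bil_vcnj_self)

text \<open>Taking u = z + w and v = z - w in the polynomial splits it by degree in w. Under the
  Gaussian of width lam, the linear part is odd, the pure quadratic forms in w and in conj(w)
  average to 0, and the mixed form contributes the trace.\<close>

lemma weyl_symbol_quadratic:
  fixes D :: "'n::finite op" and A B N :: "complex ^ 'n ^ 'n"
  assumes lam: "0 < lam"
    and ker: "\<And>u v. kernel lam D u v =
      (a + of_real lam / 4 * (u \<odot> (N *v u) - 2 * ((A *v u) \<odot> vcnj v) - vcnj v \<odot> (B *v vcnj v)))
        * exp (of_real lam / 2 * (u \<odot> vcnj v))"
  shows "integrable (mu lam) (weyl_integrand lam D z)"
    and "weyl_symbol lam D z = a + trace A / 2 + of_real lam / 4 *
      (z \<odot> (N *v z) - vcnj z \<odot> (B *v vcnj z) - 2 * ((A *v z) \<odot> vcnj z))"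
proof -
  \<comment> \<open>All cross terms between z and w; they are real linear in w, since both w and its
    conjugate occur.\<close>
  define l where "l w = z \<odot> (N *v w) + w \<odot> (N *v z) + 2 * ((A *v z) \<odot> vcnj w) - 2 * ((A *v w) \<odot> vcnj z)
    + vcnj z \<odot> (B *v vcnj w) + vcnj w \<odot> (B *v vcnj z)" for w
  define p where "p = a + of_real lam / 4 *
      (z \<odot> (N *v z) - vcnj z \<odot> (B *v vcnj z) - 2 * ((A *v z) \<odot> vcnj z))"
  define g where "g w = p + of_real lam / 4 *
      (l w + w \<odot> (N *v w) - vcnj w \<odot> (B *v vcnj w) + 2 * ((A *v w) \<odot> vcnj w))" for w
  have bl_mv: "bounded_linear ((*v) M)" for M :: "complex ^ 'n ^ 'n"
    by (rule bounded_bilinear.bounded_linear_right[OF bounded_bilinear_matrix_vector])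
  note bl = bounded_linear_compose[OF bounded_bilinear.bounded_linear_right[OF bounded_bilinear_bil]]
    bounded_linear_compose[OF bounded_bilinear.bounded_linear_left[OF bounded_bilinear_bil]]
    bounded_linear_compose[OF bl_mv] bl_mv bounded_linear_vcnj bounded_linear_ident
  have l: "bounded_linear l"
    unfolding l_def
    by (intro bounded_linear_add bounded_linear_sub bounded_linear_const_mult bl)
  have b1: "bounded_bilinear (\<lambda>v w. v \<odot> (N *v w))"
    by (intro bounded_bilinear.comp[OF bounded_bilinear_bil] bl)
  have b2: "bounded_bilinear (\<lambda>v w. vcnj v \<odot> (B *v vcnj w))"
    by (intro bounded_bilinear.comp[OF bounded_bilinear_bil] bl)
  have b3: "bounded_bilinear (\<lambda>v w. (A *v v) \<odot> vcnj w)"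
    by (intro bounded_bilinear.comp[OF bounded_bilinear_bil] bl)
  note int = integrable_gaussian_linear[OF lam l] integrable_gaussian_bilinear[OF lam b1]
    integrable_gaussian_bilinear[OF lam b2] integrable_gaussian_bilinear[OF lam b3]
  have one: "integrable (gaussian lam) (\<lambda>_::complex^'n. p)"
    by (rule integrable_gaussian_poly[OF lam, of _ "cmod p"]) (auto simp: mult_le_cancel_left1)
  have gint: "integrable (gaussian lam) g"
    unfolding g_def by (intro Bochner_Integration.integrable_add one integrable_mult_right int Bochner_Integration.integrable_diff)
  then have gm: "g \<in> borel_measurable borel"
    using borel_measurable_integrable[OF gint] by (simp add: measurable_cong_sets[OF sets_gaussian refl])
  have "integral\<^sup>L (gaussian lam :: (complex ^ 'n) measure) (\<lambda>_. p) = p"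
    using integral_gaussian_one[OF lam, where 'n='n] integral_mult_right_zero[of "gaussian lam :: (complex^'n) measure" p "\<lambda>_. 1"]
    by simp
  note const = this
  have i1: "(\<integral>w. w \<odot> (N *v w) \<partial>gaussian lam) = 0"
    by (rule integral_gaussian_bilinear[OF lam b1])
      (simp add: matrix_vector_scalar_complex bil_simps mult.assoc[symmetric])
  have ii: "cnj \<i> * cnj \<i> = -1" by simp
  have i2: "(\<integral>w. vcnj w \<odot> (B *v vcnj w) \<partial>gaussian lam) = 0"
    by (rule integral_gaussian_bilinear[OF lam b2])
      (simp add: matrix_vector_scalar_complex vcnj_simps bil_simps mult.assoc[symmetric] ii del: complex_cnj_i)
  have "(\<integral>w. g w \<partial>gaussian lam) = p + of_real lam / 4 * (2 * (trace A / of_real lam))"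
    unfolding g_def
    by (simp add: int one const integral_gaussian_linear[OF lam l] i1 i2
        integral_gaussian_sesquilinear[OF lam] del: lebesgue_integral_const)
  then have gval: "(\<integral>w. g w \<partial>gaussian lam) = p + trace A / 2"
    using lam by simp
  have weyl: "weyl_integrand lam D z w = g w * of_real (exp (- lam * (norm w)\<^sup>2))" for w
  proof -
    \<comment> \<open>(z + w) conj(z - w) cancels every term of the phase that involves z and
      doubles the term in |w|^2, leaving -lam |w|^2.\<close>
    have e: "exp (of_real lam / 2 * ((z + w) \<odot> vcnj (z - w))) * exp (of_real lam / 2 *
      (- (z \<odot> vcnj z) - (w \<odot> vcnj w) + (z \<odot> vcnj w) - (vcnj z \<odot> w)))
      = of_real (exp (- lam * (norm w)\<^sup>2))"
      unfolding exp_add[symmetric] exp_of_real[symmetric]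
      by (rule arg_cong[where f=exp])
        (simp add: bil_simps vcnj_simps of_real_norm_square bil_commute[of "vcnj z" w] algebra_simps)
    have "a + of_real lam / 4 * ((z + w) \<odot> (N *v (z + w)) - 2 * ((A *v (z + w)) \<odot> vcnj (z - w))
      - vcnj (z - w) \<odot> (B *v vcnj (z - w))) = g w"
      by (simp add: g_def p_def l_def vcnj_simps bil_simps matrix_vector_right_distrib
          matrix_vector_mult_diff_distrib algebra_simps)
    then show ?thesis
      unfolding weyl_integrand_def ker by (simp only: mult.assoc e)
  qed
  show "integrable (mu lam) (weyl_integrand lam D z)"
    using mu_eq_gaussian(2)[OF lam lam gm gint] unfolding weyl[symmetric] .
  \<comment> \<open>The prefactor 2^n compensates the mass 2^(-n) left by \<open>mu\<close> at width
    c = lam.\<close>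
  have "weyl_symbol lam D z = 2 ^ CARD('n) * (of_real ((lam / (2 * lam)) ^ CARD('n)) * (p + trace A / 2))"
    unfolding weyl_symbol_def weyl mu_eq_gaussian(1)[OF lam lam gm] gval ..
  also have "\<dots> = p + trace A / 2"
    using lam by (simp add: power_divide)
  finally show "weyl_symbol lam D z = a + trace A / 2 + of_real lam / 4 *
      (z \<odot> (N *v z) - vcnj z \<odot> (B *v vcnj z) - 2 * ((A *v z) \<odot> vcnj z))"
    by (simp add: p_def)
qed

text \<open>An antiholomorphic function paired with exp(c conj(w0) w) is evaluated at w0.
  Translation by w0 centres the Gaussian, and then only the value at the centre survives; d < c
  leaves enough Gaussian decay to dominate the quadratic exponent.\<close>

lemma gaussian_reproducing:
  fixes M :: "complex ^ 'n ^ 'n" and a w0 :: "complex ^ 'n"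
  assumes c: "0 < c" and d: "d < c" and M: "\<And>v. cmod (v \<odot> (M *v v)) \<le> d * (norm v)\<^sup>2"
  shows "(\<integral>w. exp (a \<odot> vcnj w + vcnj w \<odot> (M *v vcnj w)) * exp (of_real c * (vcnj w0 \<odot> w)) \<partial>gaussian c)
    = exp (a \<odot> vcnj w0 + vcnj w0 \<odot> (M *v vcnj w0))" 
proof -
  let ?h = "\<lambda>w. exp (a \<odot> vcnj w + vcnj w \<odot> (M *v vcnj w)) * exp (of_real c * (vcnj w0 \<odot> w))"
  let ?C = "exp (a \<odot> vcnj w0 + vcnj w0 \<odot> (M *v vcnj w0))"
  let ?dens = "\<lambda>w. (c / pi) ^ CARD('n) * exp (- c * (norm (w :: complex ^ 'n))\<^sup>2)"
  \<comment> \<open>\<alpha> and \<beta> are the parts of degree one and two in conj(w) of the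
    exponent after w is replaced by w0 + w. Expanding -c |w0 + w|^2 against c conj(w0) (w0 + w)
    cancels the holomorphic terms and leaves -c w0 conj(w), hence the second term of
    \<alpha>.\<close>
  define \<alpha> where "\<alpha> w = a \<odot> vcnj w - of_real c * (w0 \<odot> vcnj w)
    + vcnj w0 \<odot> (M *v vcnj w) + vcnj w \<odot> (M *v vcnj w0)" for w
  define \<beta> where "\<beta> w = vcnj w \<odot> (M *v vcnj w)" for w
  have bl_mv: "bounded_linear ((*v) M)"
    by (rule bounded_bilinear.bounded_linear_right[OF bounded_bilinear_matrix_vector])
  note bl = bounded_linear_compose[OF bounded_bilinear.bounded_linear_right[OF bounded_bilinear_bil]]
    bounded_linear_compose[OF bounded_bilinear.bounded_linear_left[OF bounded_bilinear_bil]]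
    bounded_linear_compose[OF bl_mv] bl_mv bounded_linear_vcnj bounded_linear_ident
  have \<alpha>: "bounded_linear \<alpha>"
    unfolding \<alpha>_def
    by (intro bounded_linear_add bounded_linear_sub bounded_linear_const_mult bl)
  have \<alpha>m: "continuous_on UNIV \<alpha>" by (rule linear_continuous_on[OF \<alpha>])
  have \<beta>m: "continuous_on UNIV \<beta>" unfolding \<beta>_def by (intro continuous_intros)
  obtain K where K: "\<And>w. norm (\<alpha> w) \<le> norm w * K"
    using bounded_linear.pos_bounded[OF \<alpha>] by blast
  have hm: "?h \<in> borel_measurable borel"
    by (intro borel_measurable_continuous_onI continuous_intros)
  have shift: "?dens (w0 + w) *\<^sub>R ?h (w0 + w) = ?dens w *\<^sub>R (?C * exp (\<alpha> w + \<beta> w))" for w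
  proof -
    have "of_real (exp (- c * (norm (w0 + w))\<^sup>2)) * ?h (w0 + w) = of_real (exp (- c * (norm w)\<^sup>2)) * (?C * exp (\<alpha> w + \<beta> w))"
      unfolding exp_of_real[symmetric] exp_add[symmetric]
      by (rule arg_cong[where f=exp])
        (simp add: \<alpha>_def \<beta>_def bil_simps vcnj_simps matrix_vector_right_distrib 
          of_real_norm_square bil_commute[of "vcnj w0"] algebra_simps)
    then show ?thesis by (simp add: scaleR_conv_of_real mult.assoc)
  qed
  have em: "(\<lambda>w. ?C * exp (\<alpha> w + \<beta> w)) \<in> borel_measurable borel"
    by (intro borel_measurable_continuous_onI continuous_intros \<alpha>m \<beta>m)
  have "(\<lambda>w. ?dens w *\<^sub>R ?h w) \<in> borel_measurable borel"
    by (intro borel_measurable_continuous_onI continuous_intros)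
  from lborel_integral_translate[OF this, of w0]
  have "(\<integral>w. ?h w \<partial>gaussian c) = (\<integral>w. ?dens w *\<^sub>R (?C * exp (\<alpha> w + \<beta> w)) \<partial>lborel)"
    unfolding gaussian_integral_iff(1)[OF c hm] shift by simp
  also have "\<dots> = (\<integral>w. ?C * exp (\<alpha> w + \<beta> w) \<partial>gaussian c)"
    unfolding gaussian_integral_iff(1)[OF c em] ..
  also have "\<dots> = ?C * (\<integral>w. exp (\<alpha> w + \<beta> w) \<partial>gaussian c)" by simp
  also have "(\<integral>w. exp (\<alpha> w + \<beta> w) \<partial>gaussian c) = 1"
  proof (rule integral_gaussian_exp_antiholo[OF c])
    show "\<alpha> \<in> borel_measurable borel" "\<beta> \<in> borel_measurable borel"
      using \<alpha>m \<beta>m by (auto intro: borel_measurable_continuous_onI)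
    show "\<alpha> (u *s w) = cnj u * \<alpha> w" for u w
      by (simp add: \<alpha>_def vcnj_simps bil_simps matrix_vector_scalar_complex algebra_simps)
    show "\<beta> (u *s w) = (cnj u)\<^sup>2 * \<beta> w" for u w
      by (simp add: \<beta>_def vcnj_simps bil_simps matrix_vector_scalar_complex power2_eq_square algebra_simps)
    show "integrable (gaussian c) (\<lambda>w. exp (cmod (\<alpha> w) + cmod (\<beta> w)))"
    proof (rule Bochner_Integration.integrable_bound[OF integrable_gaussian_exp_norm[OF c d, of K]])
      have "continuous_on UNIV (\<lambda>w. exp (cmod (\<alpha> w) + cmod (\<beta> w)))"
        by (intro continuous_intros \<alpha>m \<beta>m)
      then show "(\<lambda>w. exp (cmod (\<alpha> w) + cmod (\<beta> w))) \<in> borel_measurable (gaussian c)"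
        unfolding measurable_cong_sets[OF sets_gaussian refl] by (rule borel_measurable_continuous_onI)
      have "cmod (\<alpha> w) + cmod (\<beta> w) \<le> K * norm w + d * (norm w)\<^sup>2" for w
        using K[of w] M[of "vcnj w"] by (simp add: \<beta>_def norm_vcnj mult.commute)
      then show "AE w in gaussian c. norm (exp (cmod (\<alpha> w) + cmod (\<beta> w))) \<le> norm (exp (K * norm w + d * (norm w)\<^sup>2))"
        by simp
    qed
  qed
  finally show ?thesis by simp
qed

section \<open>Coherent states and the metaplectic kernel\<close>

lemma bounded_linear_bil_right: "bounded_linear (\<lambda>z. a \<odot> z)"
  by (rule bounded_bilinear.bounded_linear_right[OF bounded_bilinear_bil])

text \<open>\<open>op_of_kernel\<close> and \<open>d_metaplectic\<close> are unspecified off the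
  Fock space, so without this membership their values on coherent states, hence their kernels, could
  not be computed.\<close>

lemma coherent_in_fock:
  fixes w :: "complex ^ 'n"
  assumes lam: "0 < lam"
  shows "coherent lam w \<in> fock lam"
proof -
  have "entire (coherent lam w)"
    unfolding entire_def
  proof (intro allI exI conjI)
    fix z :: "complex ^ 'n"
    let ?L = "\<lambda>v. of_real lam * (vcnj w \<odot> v) / 2"
    have "bounded_linear (\<lambda>v. of_real lam / 2 * (vcnj w \<odot> v))"
      by (intro bounded_linear_const_mult bounded_linear_bil_right)
    then have "(?L has_derivative ?L) (at z)"
      by (intro bounded_linear_imp_has_derivative) simp
    then show "(coherent lam w has_derivative (\<lambda>v. exp (?L z) * ?L v)) (at z)"
      unfolding coherent_def by (rule has_derivative_compose[OF _ DERIV_exp[unfolded has_field_derivative_def]])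
    show "exp (?L z) * ?L (c *s v) = c * (exp (?L z) * ?L v)" for c v
      by (simp add: bil_simps)
  qed
  moreover have "integrable (mu lam) (\<lambda>z. (cmod (coherent lam w z))\<^sup>2 * weight lam z)"
  proof -
    have cont: "continuous_on UNIV (\<lambda>z. (cmod (coherent lam w z))\<^sup>2 * weight lam z)"
      unfolding coherent_def weight_def by (intro continuous_intros) auto
    have "integrable lborel (\<lambda>z. (cmod (coherent lam w z))\<^sup>2 * weight lam z)"
    proof (rule Bochner_Integration.integrable_bound)
      show "integrable lborel (\<lambda>z::complex^'n. exp (lam * norm w * norm z - lam / 2 * (norm z)\<^sup>2))"
        using lam by (intro integrable_gaussian_exp_linear) simp
      show "(\<lambda>z. (cmod (coherent lam w z))\<^sup>2 * weight lam z) \<in> borel_measurable lborel"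
        using borel_measurable_continuous_onI[OF cont] by simp
      have "(cmod (coherent lam w z))\<^sup>2 * weight lam z \<le> exp (lam * norm w * norm z - lam / 2 * (norm z)\<^sup>2)" for z
      proof -
        have "Re (vcnj w \<odot> z) \<le> norm w * norm z"
          using complex_Re_le_cmod[of "vcnj w \<odot> z"] norm_bil_le[of "vcnj w" z] by (simp add: norm_vcnj)
        then have "lam * Re (vcnj w \<odot> z) \<le> lam * norm w * norm z"
          using lam by simp
        moreover have "(cmod (coherent lam w z))\<^sup>2 = exp (lam * Re (vcnj w \<odot> z))"
          by (simp add: coherent_def norm_exp_eq_Re flip: exp_double)
        ultimately show ?thesis
          by (simp add: weight_def flip: exp_add)
      qed
      then show "AE z in lborel. norm ((cmod (coherent lam w z))\<^sup>2 * weight lam z)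
          \<le> norm (exp (lam * norm w * norm z - lam / 2 * (norm z)\<^sup>2))"
        by (simp add: weight_def)
    qed
    then show ?thesis
      unfolding mu_def using lam borel_measurable_continuous_onI[OF cont]
      by (subst integrable_density) auto
  qed
  ultimately show ?thesis by (simp add: fock_def)
qed

text \<open>The hypothesis on \<open>P\<^sup>-\<^sup>1 Q\<close> holds near the identity, which is all that the differential needs; it
  makes the integral defining the operator converge.\<close>

lemma metaplectic_coherent:
  fixes k :: "complex ^ ('n::finite + 'n) ^ ('n + 'n)" and z w :: "complex ^ 'n"
  assumes lam: "0 < lam" and k: "k \<in> S_group"
    and le: "\<And>v. cmod (v \<odot> ((matrix_inv (upper_left k) ** upper_right k) *v v)) \<le> (norm v)\<^sup>2"
  shows "metaplectic lam k (coherent lam w) z = b_kernel lam k z w"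
proof -
  define P' where "P' = matrix_inv (upper_left k)"
  define M where "M = (- (lam / 4)) *\<^sub>R (P' ** upper_right k)"
  define a where "a = (of_real lam / 2) *s (P' *v z)"
  define C where "C = inverse (csqrt (det (upper_left k))) *
    exp (of_real lam / 4 * (z \<odot> ((mcnj (upper_right k) ** P') *v z)))"
  have Mv: "M *v v = (- (lam / 4)) *\<^sub>R ((P' ** upper_right k) *v v)" for v
    unfolding M_def by (rule bounded_bilinear.scaleR_left[OF bounded_bilinear_matrix_vector])
  have vMv: "v \<odot> (M *v v) = - (of_real lam / 4) * (v \<odot> ((P' ** upper_right k) *v v))" for v
    unfolding Mv bil_simps by (simp add: scaleR_conv_of_real)
  have b: "b_kernel lam k z v = C * exp (a \<odot> vcnj v + vcnj v \<odot> (M *v vcnj v))" for v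
    unfolding b_kernel_def Let_def C_def P'_def[symmetric] mult.assoc exp_add[symmetric] vMv
    by (simp add: a_def bil_simps algebra_simps)
  have bound: "cmod (v \<odot> (M *v v)) \<le> lam / 4 * (norm v)\<^sup>2" for v
    using le[of v] lam unfolding Mv by (simp add: bil_simps P'_def)
  \<comment> \<open>The Fock weight is the Gaussian of width lam/2, and the quadratic exponent of
    the kernel has size at most lam/4.\<close>
  have lam': "0 < lam / 2" "lam / 4 < lam / 2" using lam by auto
  let ?g = "\<lambda>v. b_kernel lam k z v * coherent lam w v"
  have g_eq: "?g v = C * (exp (a \<odot> vcnj v + vcnj v \<odot> (M *v vcnj v)) * exp (of_real (lam / 2) * (vcnj w \<odot> v)))" for v
    by (simp add: b coherent_def mult.assoc)
  have m: "?g \<in> borel_measurable borel"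
    unfolding g_eq by (intro borel_measurable_continuous_onI continuous_intros)
  have "metaplectic lam k (coherent lam w) z = (\<integral>v. ?g v * of_real (exp (- (lam / 2) * (norm v)\<^sup>2)) \<partial>mu lam)"
    using k coherent_in_fock[OF lam, of w]
    by (simp add: metaplectic_def op_of_kernel_def weight_def)
  also have "\<dots> = (\<integral>v. ?g v \<partial>gaussian (lam / 2))"
    using lam by (subst mu_eq_gaussian(1)[OF lam'(1) lam m]) simp
  also have "\<dots> = b_kernel lam k z w"
    by (simp only: g_eq integral_mult_right_zero gaussian_reproducing[OF lam' bound]) (simp only: b)
  finally show ?thesis .
qed

subsection \<open>The matrix exponential\<close>

lemma summable_exp_bound: "summable (\<lambda>k. K ^ k / fact k :: real)"
  using summable_exp_generic[of K] by (simp add: divide_inverse mult.commute)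

text \<open>A vector is the finite sum of its coordinates under the bounded linear maps
  \<open>axis i\<close>. Applied twice, this reduces derivatives of matrices to those of
  entries.\<close>

lemma has_vector_derivative_vec:
  fixes f :: "real \<Rightarrow> 'a::real_normed_vector ^ 'n"
  assumes "\<And>i. ((\<lambda>t. f t $ i) has_vector_derivative f' $ i) F"
  shows "(f has_vector_derivative f') F"
proof -
  have expand: "x = (\<Sum>i\<in>UNIV. axis i (x $ i))" for x :: "'a ^ 'n"
    by (simp add: vec_eq_iff axis_def)
  have bl: "bounded_linear (axis i :: 'a \<Rightarrow> 'a ^ 'n)" for i
  proof (rule bounded_linear_intro[of _ 1])
    fix x :: 'a
    have "norm (axis i x) \<le> (\<Sum>j\<in>UNIV. norm (axis i x $ j))"
      unfolding norm_vec_def by (rule L2_set_le_sum) simp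
    also have "\<dots> = norm x * 1"
      by (simp add: axis_def if_distrib cong: if_cong)
    finally show "norm (axis i x) \<le> norm x * 1" .
  qed (auto simp: axis_def vec_eq_iff)
  have "((\<lambda>t. \<Sum>i\<in>UNIV. axis i (f t $ i)) has_vector_derivative (\<Sum>i\<in>UNIV. axis i (f' $ i))) F"
    by (intro has_vector_derivative_sum bounded_linear.has_vector_derivative[OF bl assms])
  then show ?thesis unfolding expand[symmetric] .
qed

abbreviation matpow :: "complex ^ 'm ^ 'm \<Rightarrow> nat \<Rightarrow> complex ^ 'm ^ 'm" where
  "matpow M k \<equiv> ((**) M ^^ k) (mat 1)"

lemma matpow_commute: "M ** matpow M k = matpow M k ** M"
  by (induction k) (simp_all add: matrix_mul_assoc)

lemma matpow_scaleR: "matpow (t *\<^sub>R M) k = t ^ k *\<^sub>R matpow M k"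
  by (induction k) (simp_all add: bounded_bilinear.scaleR_left[OF bounded_bilinear_matrix_matrix]
      bounded_bilinear.scaleR_right[OF bounded_bilinear_matrix_matrix])

lemma matpow_bound:
  fixes M :: "complex ^ 'm ^ 'm"
  obtains K C where "\<And>k. norm (matpow M k) \<le> K ^ k * C"
proof -
  obtain L where L: "\<And>(N :: complex ^ 'm ^ 'm) (N' :: complex ^ 'm ^ 'm). norm (N ** N') \<le> norm N * norm N' * L" and L0: "0 < L"
    using bounded_bilinear.pos_bounded[OF bounded_bilinear_matrix_matrix] by blast
  have "norm (matpow M k) \<le> (L * norm M) ^ k * norm (mat 1 :: complex ^ 'm ^ 'm)" for k
  proof (induction k)
    case (Suc k)
    have "norm (matpow M (Suc k)) \<le> L * norm M * norm (matpow M k)"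
      using L[of M "matpow M k"] by (simp add: mult_ac)
    also have "\<dots> \<le> L * norm M * ((L * norm M) ^ k * norm (mat 1 :: complex ^ 'm ^ 'm))"
      using Suc L0 by (intro mult_left_mono) auto
    finally show ?case by (simp add: mult_ac)
  qed simp
  then show ?thesis by (rule that)
qed

lemma summable_mexp: "summable (\<lambda>k. (1 / fact k) *\<^sub>R matpow M k)"
proof -
  obtain K C where KC: "\<And>k. norm (matpow M k) \<le> K ^ k * C" using matpow_bound by blast
  show ?thesis
  proof (rule summable_comparison_test')
    show "summable (\<lambda>k. K ^ k / fact k * C)" by (intro summable_mult2 summable_exp_bound)
    show "norm ((1 / fact k) *\<^sub>R matpow M k) \<le> K ^ k / fact k * C" for k
      using KC[of k] by (simp add: field_simps)
  qed
qed

lemma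
  fixes M :: "complex ^ 'm ^ 'm"
  shows mexp_entry: "mexp M $ i $ j = (\<Sum>k. matpow M k $ i $ j / fact k)"
  and summable_mexp_entry: "summable (\<lambda>k. matpow M k $ i $ j / fact k)"
proof -
  have bl: "bounded_linear (\<lambda>N :: complex ^ 'm ^ 'm. N $ i $ j)"
    by (intro bounded_linear_compose[OF bounded_linear_vec_nth] bounded_linear_vec_nth)
  have e: "((1 / fact k) *\<^sub>R matpow M k) $ i $ j = matpow M k $ i $ j / fact k" for k
    unfolding vector_scaleR_component by (simp add: scaleR_conv_of_real)
  show "mexp M $ i $ j = (\<Sum>k. matpow M k $ i $ j / fact k)"
    unfolding mexp_def e[symmetric] by (rule bounded_linear.suminf[OF bl summable_mexp])
  show "summable (\<lambda>k. matpow M k $ i $ j / fact k)"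
    unfolding e[symmetric] by (rule bounded_linear.summable[OF bl summable_mexp])
qed

text \<open>Each entry is an everywhere convergent power series in t and may be differentiated term
  by term.\<close>

lemma mexp_has_vector_derivative:
  "((\<lambda>t. mexp (t *\<^sub>R M)) has_vector_derivative (mexp (t *\<^sub>R M) ** M)) (at t)"
proof (intro has_vector_derivative_vec)
  fix i j
  define c where "c i j k = matpow M k $ i $ j / fact k" for i j k
  \<comment> \<open>The variable y is complex because the series is differentiated as a holomorphic
    function and restricted to real t only at the end.\<close>
  have sm: "summable (\<lambda>k. c i j k * y ^ k)" for i j and y :: complex
  proof -
    obtain K C where KC: "\<And>k. norm (matpow M k) \<le> K ^ k * C" using matpow_bound by blast
    show ?thesis
    proof (rule summable_comparison_test')
      show "summable (\<lambda>k. (K * cmod y) ^ k / fact k * C)" by (intro summable_mult2 summable_exp_bound)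
      show "norm (c i j k * y ^ k) \<le> (K * cmod y) ^ k / fact k * C" for k
      proof -
        have "cmod (matpow M k $ i $ j) \<le> K ^ k * C"
          using KC[of k] Finite_Cartesian_Product.norm_nth_le[of "matpow M k $ i" j]
            Finite_Cartesian_Product.norm_nth_le[of "matpow M k" i] by linarith
        then have "cmod (matpow M k $ i $ j) * cmod y ^ k / fact k \<le> K ^ k * C * cmod y ^ k / fact k"
          by (intro divide_right_mono mult_right_mono) auto
        then show ?thesis
          by (simp add: c_def norm_mult norm_divide norm_power power_mult_distrib mult_ac)
      qed
    qed
  qed
  have entry: "mexp (t *\<^sub>R M) $ i $ j = (\<Sum>k. c i j k * of_real t ^ k)" for t i j
    by (simp add: mexp_entry matpow_scaleR c_def) (simp add: scaleR_conv_of_real mult_ac)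
  have diffs: "diffs (c i j) k = (\<Sum>l\<in>UNIV. c i l k * M $ l $ j)" for k
  proof -
    have "diffs (c i j) k = matpow M (Suc k) $ i $ j / fact k"
      by (simp add: diffs_def c_def field_simps del: of_nat_Suc)
    also have "\<dots> = (\<Sum>l\<in>UNIV. c i l k * M $ l $ j)"
      \<comment> \<open>Commuting puts M on the right, so that the derivative mixes the blocks
        within the upper block row only, as \<open>upper_mult\<close> requires.\<close>
      unfolding funpow.simps o_apply matpow_commute
      by (simp add: c_def matrix_matrix_mult_def sum_divide_distrib)
    finally show ?thesis .
  qed
  have "((\<lambda>y. \<Sum>k. c i j k * y ^ k) has_field_derivative (\<Sum>k. diffs (c i j) k * of_real t ^ k)) (at (of_real t))"
    by (rule termdiffs_strong_converges_everywhere[OF sm])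
  also have "(\<Sum>k. diffs (c i j) k * of_real t ^ k) = (\<Sum>k. \<Sum>l\<in>UNIV. c i l k * of_real t ^ k * M $ l $ j)"
    by (simp add: diffs sum_distrib_left sum_distrib_right mult_ac)
  also have "\<dots> = (\<Sum>l\<in>UNIV. (\<Sum>k. c i l k * of_real t ^ k) * M $ l $ j)"
    unfolding suminf_sum[OF summable_mult2[OF sm]] suminf_mult2[OF sm] ..
  also have "\<dots> = (mexp (t *\<^sub>R M) ** M) $ i $ j"
    by (simp add: matrix_matrix_mult_def entry)
  finally show "((\<lambda>t. mexp (t *\<^sub>R M) $ i $ j) has_vector_derivative (mexp (t *\<^sub>R M) ** M) $ i $ j) (at t)"
    unfolding entry by (rule has_vector_derivative_real_field)
qed

lemma mexp_0: "mexp (0 :: complex ^ 'm ^ 'm) = mat 1"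
proof -
  have "(1 / fact k) *\<^sub>R matpow (0 :: complex ^ 'm ^ 'm) k = (if k = 0 then mat 1 else 0)" for k
    by (cases k) simp_all
  then have "mexp (0 :: complex ^ 'm ^ 'm) = (\<Sum>k. if k = 0 then mat 1 else 0)"
    unfolding mexp_def by simp
  also have "\<dots> = mat 1" using sums_single[of 0 "\<lambda>_. mat 1 :: complex ^ 'm ^ 'm"] by (simp add: sums_iff)
  finally show ?thesis .
qed

subsection \<open>The exponential map into the group\<close>

lemma bounded_linear_upper_left: "bounded_linear upper_left"
  and bounded_linear_upper_right: "bounded_linear upper_right"
  by (auto intro!: linear_conv_bounded_linear[THEN iffD1] linearI simp: upper_left_def upper_right_def vec_eq_iff)

lemma bounded_linear_mcnj: "bounded_linear (mcnj :: complex ^ 'n ^ 'm \<Rightarrow> _)"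
  by (auto intro!: linear_conv_bounded_linear[THEN iffD1] linearI simp: vec_eq_iff)

lemma bounded_linear_transpose: "bounded_linear (transpose :: complex ^ 'n ^ 'm \<Rightarrow> _)"
  by (auto intro!: linear_conv_bounded_linear[THEN iffD1] linearI simp: transpose_def vec_eq_iff)

lemma bounded_linear_adjmat: "bounded_linear (adjmat :: complex ^ 'n ^ 'm \<Rightarrow> _)"
  unfolding adjmat_def by (rule bounded_linear_compose[OF bounded_linear_transpose bounded_linear_mcnj])

lemma upper_block [simp]: "upper_left (block P Q R T) = P" "upper_right (block P Q R T) = Q"
  by (simp_all add: upper_left_def upper_right_def block_def vec_eq_iff)

lemma sum_UNIV_Plus: "(\<Sum>x\<in>(UNIV :: ('a::finite + 'b::finite) set). f x) = (\<Sum>x\<in>UNIV. f (Inl x)) + (\<Sum>x\<in>UNIV. f (Inr x))"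
  by (subst UNIV_Plus_UNIV[symmetric], subst sum.Plus) (simp_all add: o_def)

lemma upper_mult:
  "upper_left (M ** block A B C D) = upper_left M ** A + upper_right M ** C"
  "upper_right (M ** block A B C D) = upper_left M ** B + upper_right M ** D"
  by (simp_all add: upper_left_def upper_right_def block_def vec_eq_iff matrix_matrix_mult_def sum_UNIV_Plus)

lemma mcnj_matrix_simps:
  "mcnj (M ** N) = mcnj M ** mcnj N" "mcnj (M + N) = mcnj M + mcnj N" "mcnj (mcnj M) = M"
  by (simp_all add: vec_eq_iff matrix_matrix_mult_def)

text \<open>The shape shared by the group and its Lie algebra, as a condition on entries: in this
  form it passes through products and convergent series, hence to the exponential.\<close>

definition conj_block :: "complex ^ ('n::finite + 'n) ^ ('n + 'n) \<Rightarrow> bool" where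
  "conj_block M \<longleftrightarrow> (\<forall>a b. M $ Inr a $ Inr b = cnj (M $ Inl a $ Inl b) \<and> M $ Inr a $ Inl b = cnj (M $ Inl a $ Inr b))"

lemma conj_block_eq: "conj_block M \<Longrightarrow> M = block (upper_left M) (upper_right M) (mcnj (upper_right M)) (mcnj (upper_left M))"
  by (simp add: conj_block_def vec_eq_iff block_def upper_left_def upper_right_def split: sum.split)

lemma conj_block_block: "conj_block (block A B (mcnj B) (mcnj A))"
  by (simp add: conj_block_def block_def)

lemma conj_block_mult: "conj_block M \<Longrightarrow> conj_block N \<Longrightarrow> conj_block (M ** N)"
  by (simp add: conj_block_def matrix_matrix_mult_def sum_UNIV_Plus algebra_simps)

lemma conj_block_mexp:
  assumes "conj_block M"
  shows "conj_block (mexp M)"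
proof -
  have "conj_block (matpow M k)" for k
  proof (induction k)
    case 0 show ?case by (simp add: conj_block_def mat_def)
  qed (simp add: conj_block_mult assms)
  then show ?thesis
    unfolding conj_block_def mexp_entry
    by (simp add: bounded_linear.suminf[OF bounded_linear_cnj summable_mexp_entry])
qed

text \<open>The two group relations say that upper left blocks of E J E* and of E W E^t keep their
  initial values, for J = diag(1, -1) and the standard symplectic matrix W. Along E' = E X their
  derivatives vanish because A* = -A and B^t = B.\<close>

lemma mexp_in_S_group:
  assumes X: "block A B (mcnj B) (mcnj A) \<in> s_algebra"
  shows "mexp (t *\<^sub>R block A B (mcnj B) (mcnj A)) \<in> S_group"
proof -
  let ?X = "block A B (mcnj B) (mcnj A)"
  \<comment> \<open>Membership only provides some blocks; comparing upper rows identifies them with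
    A and B.\<close>
  obtain A' B' where "?X = block A' B' (mcnj B') (mcnj A')" "adjmat A' = - A'" "transpose B' = B'"
    using X unfolding s_algebra_def by blast
  then have A: "adjmat A = - A" and B: "transpose B = B"
    by (metis upper_block)+
  have tm: "transpose (mcnj M) = mcnj (transpose M)" and mm: "mcnj (- M) = - mcnj M" for M :: "complex ^ 'n ^ 'n"
    by (simp_all add: transpose_def vec_eq_iff)
  have "mcnj (transpose A) = - A"
    using A by (simp add: adjmat_def tm)
  then have A2: "transpose A = - mcnj A" "transpose (mcnj A) = - A"
    by (metis mcnj_matrix_simps(3) mm, simp add: tm)
  have B2: "adjmat B = mcnj B" "transpose (mcnj B) = mcnj B" "adjmat (mcnj B) = B" "adjmat (mcnj A) = - mcnj A"
    by (simp_all add: adjmat_def tm B A2 mm mcnj_matrix_simps)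
  define E where "E t = mexp (t *\<^sub>R ?X)" for t
  define P where "P t = upper_left (E t)" for t
  define Q where "Q t = upper_right (E t)" for t
  have E: "(E has_vector_derivative E t ** ?X) (at t)" for t
    unfolding E_def by (rule mexp_has_vector_derivative)
  have P: "(P has_vector_derivative P t ** A + Q t ** mcnj B) (at t)" for t
    using bounded_linear.has_vector_derivative[OF bounded_linear_upper_left E, of t]
    by (simp add: P_def[abs_def] Q_def[abs_def] upper_mult)
  have Q: "(Q has_vector_derivative P t ** B + Q t ** mcnj A) (at t)" for t
    using bounded_linear.has_vector_derivative[OF bounded_linear_upper_right E, of t]
    by (simp add: P_def[abs_def] Q_def[abs_def] upper_mult)
  have adj: "adjmat (M ** N) = adjmat N ** adjmat M" "adjmat (M + N) = adjmat M + adjmat N" for M N :: "complex ^ 'n ^ 'n"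
    by (simp_all add: adjmat_def mcnj_matrix_simps matrix_transpose_mul) (simp add: transpose_def vec_eq_iff)
  have tr: "transpose (M + N) = transpose M + transpose N" for M N :: "complex ^ 'n ^ 'n"
    by (simp add: transpose_def vec_eq_iff)
  note mm = bounded_bilinear.has_vector_derivative[OF bounded_bilinear_matrix_matrix]
  note neg = bounded_bilinear.minus_left[OF bounded_bilinear_matrix_matrix]
    bounded_bilinear.minus_right[OF bounded_bilinear_matrix_matrix]
    bounded_bilinear.diff_left[OF bounded_bilinear_matrix_matrix]
    bounded_bilinear.diff_right[OF bounded_bilinear_matrix_matrix]
  define G where "G t = P t ** adjmat (P t) - Q t ** adjmat (Q t)" for t
  define H where "H t = P t ** transpose (Q t) - Q t ** transpose (P t)" for t
  note bladj = bounded_linear.has_vector_derivative[OF bounded_linear_adjmat]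
  note bltr = bounded_linear.has_vector_derivative[OF bounded_linear_transpose]
  have G: "(G has_vector_derivative 0) (at t)" for t
    unfolding G_def[abs_def]
    by (rule has_vector_derivative_eq_rhs[OF has_vector_derivative_diff[OF mm[OF P bladj[OF P]] mm[OF Q bladj[OF Q]]]])
      (simp add: adj A B2 matrix_add_ldistrib bounded_bilinear.add_left[OF bounded_bilinear_matrix_matrix] matrix_mul_assoc neg)
  have H: "(H has_vector_derivative 0) (at t)" for t
    unfolding H_def[abs_def]
    by (rule has_vector_derivative_eq_rhs[OF has_vector_derivative_diff[OF mm[OF P bltr[OF Q]] mm[OF Q bltr[OF P]]]])
      (simp add: tr A2 B B2 matrix_transpose_mul matrix_add_ldistrib bounded_bilinear.add_left[OF bounded_bilinear_matrix_matrix] matrix_mul_assoc neg)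
  have E0: "E 0 = mat 1" by (simp add: E_def mexp_0)
  have P0: "P 0 = mat 1" and Q0: "Q 0 = 0"
    by (simp_all add: P_def Q_def E0 upper_left_def upper_right_def mat_def vec_eq_iff)
  have "G t = G 0"
    using has_vector_derivative_zero_constant[of UNIV G] G by (metis UNIV_I convex_UNIV)
  then have 1: "P t ** adjmat (P t) - Q t ** adjmat (Q t) = mat 1"
    by (simp add: G_def P0 Q0) (simp add: adjmat_def transpose_def vec_eq_iff mat_def)
  have "H t = H 0"
    using has_vector_derivative_zero_constant[of UNIV H] H by (metis UNIV_I convex_UNIV)
  then have 2: "P t ** transpose (Q t) = Q t ** transpose (P t)"
    by (simp add: H_def P0 Q0) (simp add: transpose_def vec_eq_iff mat_def)
  have "conj_block (t *\<^sub>R ?X)"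
    using conj_block_block[of A B] by (simp add: conj_block_def)
  then have "E t = block (P t) (Q t) (mcnj (Q t)) (mcnj (P t))"
    unfolding E_def P_def Q_def by (intro conj_block_eq conj_block_mexp)
  then show ?thesis
    using 1 2 unfolding S_group_def E_def by blast
qed

subsection \<open>Derivatives of determinant and inverse at the identity\<close>

lemma bounded_linear_entry: "bounded_linear (\<lambda>M :: complex ^ 'n ^ 'm. M $ i $ j)"
  by (intro bounded_linear_compose[OF bounded_linear_vec_nth] bounded_linear_vec_nth)

lemma has_vector_derivative_det:
  fixes M :: "real \<Rightarrow> complex ^ 'n ^ 'n"
  assumes M: "(M has_vector_derivative M') (at t)"
  shows "((\<lambda>t. det (M t)) has_vector_derivative
    (\<Sum>p | p permutes UNIV. of_int (sign p) * (\<Sum>i\<in>UNIV. M' $ i $ p i * (\<Prod>j\<in>UNIV - {i}. M t $ j $ p j)))) (at t)"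
proof -
  have entry: "((\<lambda>t. M t $ i $ j) has_derivative (\<lambda>h. h *\<^sub>R M' $ i $ j)) (at t)" for i j
    using bounded_linear.has_vector_derivative[OF bounded_linear_entry M, of i j]
    by (simp add: has_vector_derivative_def)
  have prd: "((\<lambda>t. \<Prod>i\<in>UNIV. M t $ i $ p i) has_vector_derivative
      (\<Sum>i\<in>UNIV. M' $ i $ p i * (\<Prod>j\<in>UNIV - {i}. M t $ j $ p j))) (at t)" for p
    using has_derivative_prod[of UNIV "\<lambda>i t. M t $ i $ p i" "\<lambda>i h. h *\<^sub>R M' $ i $ p i" t UNIV] entry
    by (simp add: has_vector_derivative_def scaleR_sum_right)
  show ?thesis
    unfolding det_def by (intro has_vector_derivative_sum has_vector_derivative_mult_right prd)
qed

text \<open>Jacobi's formula at the identity. A permutation other than \<open>id\<close> moves at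
  least two indices, so after one factor is differentiated an off-diagonal zero remains.\<close>

lemma has_vector_derivative_det_at_one:
  fixes M :: "real \<Rightarrow> complex ^ 'n ^ 'n"
  assumes M: "(M has_vector_derivative M') (at t)" and one: "M t = mat 1"
  shows "((\<lambda>t. det (M t)) has_vector_derivative trace M') (at t)"
proof -
  let ?f = "\<lambda>p. of_int (sign p) * (\<Sum>i\<in>UNIV. M' $ i $ p i * (\<Prod>j\<in>UNIV - {i}. M t $ j $ p j))"
  have 0: "?f p = 0" if p: "p permutes UNIV" and "p \<noteq> id" for p :: "'n \<Rightarrow> 'n"
  proof -
    have "\<exists>j\<in>UNIV - {i}. M t $ j $ p j = 0" for i
    proof (rule ccontr)
      assume "\<not> ?thesis"
      then have fixed: "p j = j" if "j \<noteq> i" for j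
        using that by (auto simp: one mat_def split: if_splits)
      moreover have "p i = i"
        using permutes_inj[OF p] fixed[of "p i"] by (metis injD)
      ultimately have "p = id" by (metis eq_id_iff)
      with \<open>p \<noteq> id\<close> show False by simp
    qed
    then have z: "(\<Prod>j\<in>UNIV - {i}. M t $ j $ p j) = 0" for i
      by (simp add: prod_zero_iff)
    show ?thesis by (simp only: z mult_zero_right sum.neutral_const)
  qed
  have "(\<Sum>p | p permutes UNIV. ?f p) = (\<Sum>p\<in>{id}. ?f p)"
    using 0 by (intro sum.mono_neutral_right) (auto simp: permutes_id finite_permutations)
  also have "\<dots> = trace M'"
    by (simp add: one mat_def trace_def sign_id)
  finally show ?thesis
    using has_vector_derivative_det[OF M] by simp
qed

lemma matrix_inv_det_nonzero:
  fixes M :: "complex ^ 'n ^ 'n"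
  assumes "det M \<noteq> 0"
  shows "M ** matrix_inv M = mat 1" "matrix_inv M ** M = mat 1"
proof -
  have "\<exists>N. M ** N = mat 1 \<and> N ** M = mat 1"
    using assms by (simp add: invertible_det_nz flip: invertible_def)
  then have "M ** matrix_inv M = mat 1 \<and> matrix_inv M ** M = mat 1"
    unfolding matrix_inv_def by (rule someI_ex)
  then show "M ** matrix_inv M = mat 1" "matrix_inv M ** M = mat 1" by auto
qed

text \<open>Cramer's rule presents the inverse as a quotient of determinants, from which its
  differentiability can be read off.\<close>

lemma matrix_inv_entry:
  fixes M :: "complex ^ 'n ^ 'n"
  assumes "det M \<noteq> 0"
  shows "matrix_inv M $ i $ k = det (\<chi> a b. if b = i then axis k 1 $ a else M $ a $ b) / det M"
proof -
  have "M *v (matrix_inv M *v axis k 1) = axis k 1"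
    using assms by (simp add: matrix_vector_mul_assoc matrix_inv_det_nonzero)
  then have "matrix_inv M *v axis k 1 = (\<chi> i. det (\<chi> a b. if b = i then axis k 1 $ a else M $ a $ b) / det M)"
    by (simp add: cramer[OF assms])
  moreover have "(matrix_inv M *v axis k 1) $ i = matrix_inv M $ i $ k"
    by (simp add: matrix_vector_mult_def axis_def if_distrib cong: if_cong)
  ultimately show ?thesis by simp
qed

lemma eventually_det_nonzero:
  fixes M :: "real \<Rightarrow> complex ^ 'n ^ 'n"
  assumes M: "(M has_vector_derivative M') (at t)" and one: "M t = mat 1"
  shows "eventually (\<lambda>s. det (M s) \<noteq> 0) (nhds t)"
proof -
  have "isCont (\<lambda>s. det (M s)) t"
    by (rule has_vector_derivative_continuous[OF has_vector_derivative_det[OF M]])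
  then have "eventually (\<lambda>s. det (M s) \<noteq> 0) (at t)"
    by (rule tendsto_imp_eventually_ne[OF isContD]) (simp add: one)
  then show ?thesis by (auto simp: eventually_nhds_conv_at one)
qed

text \<open>Cramer's rule yields only the existence of a derivative; its value follows from the
  product rule for \<open>matrix_inv (M s) ** M s\<close>, which is constant near t.\<close>

lemma has_vector_derivative_matrix_inv_at_one:
  fixes M :: "real \<Rightarrow> complex ^ 'n ^ 'n"
  assumes M: "(M has_vector_derivative M') (at t)" and one: "M t = mat 1"
  shows "((\<lambda>s. matrix_inv (M s)) has_vector_derivative - M') (at t)"
proof -
  let ?R = "\<lambda>s. matrix_inv (M s)"
  note nz = eventually_det_nonzero[OF M one]
  have dt: "det (M t) \<noteq> 0" by (simp add: one)
  have "\<exists>d. ((\<lambda>s. ?R s $ i $ k) has_vector_derivative d) (at t)" for i k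
  proof -
    \<comment> \<open>Column i is replaced by a constant unit vector, which therefore has derivative
      0.\<close>
    let ?N = "\<lambda>s. \<chi> a b. if b = i then axis k 1 $ a else M s $ a $ b"
    have "(?N has_vector_derivative (\<chi> a b. if b = i then 0 else M' $ a $ b)) (at t)"
    proof (intro has_vector_derivative_vec)
      fix a b
      have "((\<lambda>s. M s $ a $ b) has_vector_derivative M' $ a $ b) (at t)"
        by (rule bounded_linear.has_vector_derivative[OF bounded_linear_entry M])
      then show "((\<lambda>s. ?N s $ a $ b) has_vector_derivative (\<chi> a b. if b = i then 0 else M' $ a $ b) $ a $ b) (at t)"
        by (cases "b = i") simp_all
    qed
    note N = has_vector_derivative_det[OF this]
    have "\<exists>d. ((\<lambda>s. det (?N s) / det (M s)) has_vector_derivative d) (at t)"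
      using differentiable_divide[OF differentiableI_vector[OF N]
          differentiableI_vector[OF has_vector_derivative_det[OF M]] dt]
      by (auto simp: vector_derivative_works)
    then obtain d where d: "((\<lambda>s. det (?N s) / det (M s)) has_vector_derivative d) (at t)" by blast
    have "((\<lambda>s. ?R s $ i $ k) has_vector_derivative d) (at t)"
    proof (rule has_vector_derivative_cong_ev[where
          g = "\<lambda>s. det (?N s) / det (M s)", THEN iffD2])
      show "?R t $ i $ k = det (?N t) / det (M t)" by (rule matrix_inv_entry[OF dt])
      show "\<forall>\<^sub>F s in nhds t. s \<in> UNIV \<longrightarrow> ?R s $ i $ k = det (?N s) / det (M s)"
        using nz by eventually_elim (simp add: matrix_inv_entry)
    qed (rule d)
    then show ?thesis by blast
  qed
  then obtain d where d: "\<And>i k. ((\<lambda>s. ?R s $ i $ k) has_vector_derivative d i k) (at t)" by metis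
  have R: "(?R has_vector_derivative (\<chi> i k. d i k)) (at t)"
    by (intro has_vector_derivative_vec) (simp add: d)
  have Rt: "?R t = mat 1"
    using matrix_inv_det_nonzero[OF dt] by (simp add: one)
  have "((\<lambda>s. ?R s ** M s) has_vector_derivative (?R t ** M' + (\<chi> i k. d i k) ** M t)) (at t)"
    by (rule bounded_bilinear.has_vector_derivative[OF bounded_bilinear_matrix_matrix R M])
  moreover have "((\<lambda>s. ?R s ** M s) has_vector_derivative 0) (at t)"
  proof (subst has_vector_derivative_cong_ev[where g = "\<lambda>_. mat 1"])
    show "\<forall>\<^sub>F s in nhds t. s \<in> UNIV \<longrightarrow> ?R s ** M s = mat 1"
      using nz by eventually_elim (simp add: matrix_inv_det_nonzero)
  qed (simp_all add: Rt[unfolded one] one)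
  ultimately have "?R t ** M' + (\<chi> i k. d i k) ** M t = 0"
    by (rule vector_derivative_unique_at)
  then have "(\<chi> i k. d i k) = - M'"
    by (simp add: Rt[unfolded one] one eq_neg_iff_add_eq_0 add.commute)
  with R show ?thesis by simp
qed

subsection \<open>The differential of the metaplectic representation\<close>

lemma has_vector_derivative_b_kernel:
  fixes E :: "real \<Rightarrow> complex ^ ('n::finite + 'n) ^ ('n + 'n)"
  assumes E: "(E has_vector_derivative block A B C D) (at 0)" and E0: "E 0 = mat 1"
  shows "((\<lambda>t. b_kernel lam (E t) z w) has_vector_derivative
    (- trace A / 2 + of_real lam / 4 * (z \<odot> (mcnj B *v z) - 2 * ((A *v z) \<odot> vcnj w) - vcnj w \<odot> (B *v vcnj w)))
      * exp (of_real lam / 2 * (z \<odot> vcnj w))) (at 0)"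
proof -
  define P where "P t = upper_left (E t)" for t
  define Q where "Q t = upper_right (E t)" for t
  define R where "R t = matrix_inv (P t)" for t
  have P0: "P 0 = mat 1" and Q0: "Q 0 = 0"
    by (simp_all add: P_def Q_def E0 upper_left_def upper_right_def mat_def vec_eq_iff)
  have P: "(P has_vector_derivative A) (at 0)" and Q: "(Q has_vector_derivative B) (at 0)"
    using bounded_linear.has_vector_derivative[OF bounded_linear_upper_left E]
      bounded_linear.has_vector_derivative[OF bounded_linear_upper_right E]
    by (simp_all add: P_def[abs_def] Q_def[abs_def])
  have R: "(R has_vector_derivative - A) (at 0)"
    unfolding R_def[abs_def] by (rule has_vector_derivative_matrix_inv_at_one[OF P P0])
  have R0: "R 0 = mat 1"
    using matrix_inv_det_nonzero(1)[of "mat 1 :: complex ^ 'n ^ 'n"] by (simp add: R_def P0)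
  have lin: "((\<lambda>t. u \<odot> (M t *v v)) has_vector_derivative u \<odot> (M' *v v)) (at 0)"
    if "(M has_vector_derivative M') (at 0)" for M M' and u v :: "complex ^ 'n"
    by (rule bounded_linear.has_vector_derivative[OF _ that])
      (intro bounded_linear_compose[OF bounded_linear_bil_right]
        bounded_bilinear.bounded_linear_left[OF bounded_bilinear_matrix_vector])
  note mm = bounded_bilinear.has_vector_derivative[OF bounded_bilinear_matrix_matrix]
  note zero = bounded_bilinear.zero_left[OF bounded_bilinear_matrix_matrix]
    bounded_bilinear.zero_right[OF bounded_bilinear_matrix_matrix]
  note Qc = bounded_linear.has_vector_derivative[OF bounded_linear_mcnj Q]
  have mc0: "mcnj 0 = (0 :: complex ^ 'n ^ 'n)" by (simp add: vec_eq_iff)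
  \<comment> \<open>The exponent of the kernel without its factor lam/4; the middle product is
    flipped so that all three terms fit \<open>lin\<close>. As Q 0 = 0 and R 0 = 1, the derivative
    of R survives only in the middle term.\<close>
  define q where "q t = z \<odot> ((mcnj (Q t) ** R t) *v z) + 2 * (vcnj w \<odot> (R t *v z))
    - vcnj w \<odot> ((R t ** Q t) *v vcnj w)" for t
  let ?q' = "z \<odot> (mcnj B *v z) - 2 * ((A *v z) \<odot> vcnj w) - vcnj w \<odot> (B *v vcnj w)"
  have "(q has_vector_derivative ?q') (at 0)"
    unfolding q_def[abs_def]
    by (rule has_vector_derivative_eq_rhs[OF has_vector_derivative_diff[OF has_vector_derivative_add[OF
          lin[OF mm[OF Qc R]] has_vector_derivative_mult_right[OF lin[OF R]]] lin[OF mm[OF R Q]]]])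
      (simp add: R0 Q0 mc0 zero bil_simps bil_commute[of _ "vcnj w"]
        bounded_bilinear.minus_left[OF bounded_bilinear_matrix_vector])
  then have "((\<lambda>t. of_real lam / 4 * q t) has_vector_derivative of_real lam / 4 * ?q') (at 0)"
    by (rule has_vector_derivative_mult_right)
  from field_vector_diff_chain_at[OF this DERIV_exp]
  have ex: "((\<lambda>t. exp (of_real lam / 4 * q t)) has_vector_derivative
      of_real lam / 4 * ?q' * exp (of_real lam / 4 * q 0)) (at 0)"
    by (simp add: o_def)
  \<comment> \<open>The principal root is holomorphic near det (P 0) = 1, away from its cut; this
    derivative is the origin of the factor -1/2 before the trace.\<close>
  have "((\<lambda>x. inverse (csqrt x)) has_field_derivative - (1 / 2)) (at 1)"
    by (auto intro!: derivative_eq_intros)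
  then have "((\<lambda>x. inverse (csqrt x)) has_field_derivative - (1 / 2)) (at (det (P 0)))"
    by (simp add: P0)
  from field_vector_diff_chain_at[OF has_vector_derivative_det_at_one[OF P P0] this]
  have dt: "((\<lambda>t. inverse (csqrt (det (P t)))) has_vector_derivative - trace A / 2) (at 0)"
    by (simp add: o_def)
  have q0: "q 0 = 2 * (z \<odot> vcnj w)"
    by (simp add: q_def R0 Q0 mc0 zero bil_simps bil_commute[of z "vcnj w"])
  have "((\<lambda>t. inverse (csqrt (det (P t))) * exp (of_real lam / 4 * q t)) has_vector_derivative
      (- trace A / 2 + of_real lam / 4 * ?q') * exp (of_real lam / 2 * (z \<odot> vcnj w))) (at 0)"
    by (rule has_vector_derivative_eq_rhs[OF has_vector_derivative_mult[OF dt ex]])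
      (simp add: q0 P0 algebra_simps)
  moreover have "b_kernel lam (E t) z w = inverse (csqrt (det (P t))) * exp (of_real lam / 4 * q t)" for t
    by (simp add: b_kernel_def Let_def P_def Q_def R_def q_def bil_commute[of "vcnj w" "_ *v z"])
  ultimately show ?thesis by simp
qed

lemma has_vector_derivative_metaplectic_coherent:
  fixes A B :: "complex ^ 'n ^ 'n"
  assumes lam: "0 < lam" and X: "block A B (mcnj B) (mcnj A) \<in> s_algebra"
  shows "((\<lambda>t. metaplectic lam (mexp (t *\<^sub>R block A B (mcnj B) (mcnj A))) (coherent lam w) z) has_vector_derivative
    (- trace A / 2 + of_real lam / 4 * (z \<odot> (mcnj B *v z) - 2 * ((A *v z) \<odot> vcnj w) - vcnj w \<odot> (B *v vcnj w)))
      * exp (of_real lam / 2 * (z \<odot> vcnj w))) (at 0)"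
proof -
  let ?X = "block A B (mcnj B) (mcnj A)"
  let ?E = "\<lambda>t. mexp (t *\<^sub>R ?X)"
  have E0: "?E 0 = mat 1" by (simp add: mexp_0)
  have E: "(?E has_vector_derivative ?X) (at 0)"
    using mexp_has_vector_derivative[of ?X 0] by (simp add: mexp_0)
  let ?M = "\<lambda>t. matrix_inv (upper_left (?E t)) ** upper_right (?E t)"
  have P0: "upper_left (?E 0) = mat 1" and Q0: "upper_right (?E 0) = 0"
    unfolding E0 by (simp_all add: upper_left_def upper_right_def mat_def vec_eq_iff)
  have P: "((\<lambda>t. upper_left (?E t)) has_vector_derivative A) (at 0)"
    using bounded_linear.has_vector_derivative[OF bounded_linear_upper_left E] by simp
  have Q: "((\<lambda>t. upper_right (?E t)) has_vector_derivative B) (at 0)"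
    using bounded_linear.has_vector_derivative[OF bounded_linear_upper_right E] by simp
  have "isCont ?M 0"
    by (rule has_vector_derivative_continuous[OF bounded_bilinear.has_vector_derivative[OF
          bounded_bilinear_matrix_matrix has_vector_derivative_matrix_inv_at_one[OF P P0] Q]])
  moreover have M0: "?M 0 = 0" unfolding Q0 by simp
  ultimately have lim: "((\<lambda>t. norm (?M t)) \<longlongrightarrow> 0) (at 0)"
    by (simp only: isCont_def) (rule tendsto_norm_zero)
  obtain K where K: "\<And>(N :: complex ^ 'n ^ 'n) (v :: complex ^ 'n). norm (N *v v) \<le> norm N * norm v * K" and K0: "0 < K"
    using bounded_bilinear.pos_bounded[OF bounded_bilinear_matrix_vector] by blast
  \<comment> \<open>K is the constant in the bound for matrix-vector products, so this threshold
    makes the quadratic form of \<open>?M t\<close> at most (norm v)^2.\<close>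
  have "eventually (\<lambda>t. norm (?M t) < 1 / K) (at 0)"
    using order_tendstoD(2)[OF lim, of "1 / K"] K0 by simp
  \<comment> \<open>The point t = 0 is included, since transferring the derivative also needs
    equality there.\<close>
  then have "eventually (\<lambda>t. norm (?M t) < 1 / K) (nhds 0)"
    unfolding eventually_nhds_conv_at using K0 M0 by simp
  then have ev: "eventually (\<lambda>t. t \<in> UNIV \<longrightarrow> metaplectic lam (?E t) (coherent lam w) z = b_kernel lam (?E t) z w) (nhds 0)"
  proof eventually_elim
    case (elim t)
    have "cmod (v \<odot> (?M t *v v)) \<le> (norm v)\<^sup>2" for v
    proof -
      have "cmod (v \<odot> (?M t *v v)) \<le> norm v * (norm (?M t) * norm v * K)"
        by (rule order_trans[OF norm_bil_le mult_left_mono[OF K]]) simp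
      also have "\<dots> = (norm (?M t) * K) * (norm v)\<^sup>2"
        by (simp add: power2_eq_square)
      also have "\<dots> \<le> 1 * (norm v)\<^sup>2"
        using elim K0 by (intro mult_right_mono) (simp_all add: field_simps)
      finally show ?thesis by simp
    qed
    then show ?case using metaplectic_coherent[OF lam mexp_in_S_group[OF X]] by blast
  qed
  then have "metaplectic lam (?E 0) (coherent lam w) z = b_kernel lam (?E 0) z w"
    by (auto dest: eventually_nhds_x_imp_x)
  then show ?thesis
    using has_vector_derivative_cong_ev[OF ev] has_vector_derivative_b_kernel[OF E E0] by blast
qed

text \<open>\<open>vector_derivative\<close> and the Bochner integral return a value even where no
  derivative or integral exists; the clauses on differentiability and integrability exclude that the
  formula rests on such defaults.\<close>

theorem proposition7p4:
  fixes lam :: real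
    and A B :: "complex ^ 'n ^ 'n"
    and X :: "complex ^ ('n + 'n) ^ ('n + 'n)"
  assumes "lam > 0"
    and "X = block A B (mcnj B) (mcnj A)"
    and "X \<in> s_algebra"
  shows "(\<forall>u w :: complex ^ 'n.
            (\<lambda>t::real. metaplectic lam (mexp (t *\<^sub>R X)) (coherent lam w) u)
              differentiable (at 0)) \<and>
         (\<forall>z :: complex ^ 'n.
            integrable (mu lam) (weyl_integrand lam (d_metaplectic lam X) z) \<and>
            weyl_symbol lam (d_metaplectic lam X) z =
              of_real lam / 4 *
                (z \<odot> (mcnj B *v z) - vcnj z \<odot> (B *v vcnj z) - 2 * ((A *v z) \<odot> vcnj z)))"
proof -
  have d: "((\<lambda>t. metaplectic lam (mexp (t *\<^sub>R X)) (coherent lam w) u) has_vector_derivative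
    (- trace A / 2 + of_real lam / 4 * (u \<odot> (mcnj B *v u) - 2 * ((A *v u) \<odot> vcnj w) - vcnj w \<odot> (B *v vcnj w)))
      * exp (of_real lam / 2 * (u \<odot> vcnj w))) (at 0)" for u w
    using has_vector_derivative_metaplectic_coherent[of lam A B w u] assms by simp
  have "kernel lam (d_metaplectic lam X) u w =
    (- trace A / 2 + of_real lam / 4 * (u \<odot> (mcnj B *v u) - 2 * ((A *v u) \<odot> vcnj w) - vcnj w \<odot> (B *v vcnj w)))
      * exp (of_real lam / 2 * (u \<odot> vcnj w))" for u w
    using vector_derivative_at[OF d] coherent_in_fock[OF assms(1), of w]
    by (simp add: kernel_def d_metaplectic_def)
  \<comment> \<open>Here the constant a is - trace A / 2 and N is \<open>mcnj B\<close>, so the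
    trace terms cancel.\<close>
  note weyl = weyl_symbol_quadratic[OF assms(1) this]
  show ?thesis
    using weyl differentiableI_vector[OF d] by simp
qed

end
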